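(* Let $\hat F\ne0$, $\hat p<0$, let $\hat L(X)$ be a monotonically increasing function, and let $x(t,x_0)$ be the solution of $\dot x=A(t)x+f(t,x)+F(t)$, $x(t_0,x_0)=x_0$. Let $Q(X,\hat F)=\hat pX+\hat k\hat L(X)+\hat k\hat F$. (1) Assume that $d_1>d_2>0$ are the (positive) roots of $Q(X,\hat F)=0$, corresponding to unstable ($X=d_1$) and stable ($X=d_2$) fixed solutions of $\dot X=Q(X,\hat F)$. Then, for all $t\ge t_0$, $$\|x(t,x_0)\|\le\begin{cases} d_1, & \text{for all } x_0\in\omega(t_0,d_1),\\ d_2, & \text{for all } x_0\in\omega(t_0,d_2),\end{cases}$$ and $$\limsup_{t\to\infty}\|x(t,x_0)\|\le d_2\quad\text{for all } x_0\in\omega(t_0,d_1).$$ (2) Let $d_1=d_2=d$ (the two positive roots of $Q(X,\hat F)=0$ coincide). Then $\|x(t,x_0)\|\le d$ for all $x_0\in\omega(t_0,d)$ and $t\ge t_0$.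
   Context: Consider $\dot x=A(t)x+f(t,x)+F(t)$, $t\in[t_0,\infty)$, $x\in\mathbb{R}^n$, $f(t,0)=0$, where $A(t)\in\mathbb{R}^{n\times n}$, $f:[t_0,\infty)\times\mathbb{R}^n\to\mathbb{R}^n$ and $F(t)\in\mathbb{R}^n$ are continuous and bounded, and $A$ is continuously differentiable. The solution $x(t,x_0)$ is assumed to be uniquely defined for all $t\ge t_0$. $\|\cdot\|$ is the Euclidean norm for vectors and the induced (spectral) norm for matrices. $W(t)$ is a fundamental solution matrix of $\dot x=A(t)x$ with $\|W(t_0)\|=1$; $\sigma_{\max}(t)$, $\sigma_{\min}(t)$ are its largest and smallest singular values; $\sigma_{\max}(t)$ is unique (simple) for every $t\ge t_0$, and $\sup_{t\ge t_0}\sigma_{\max}\le\bar\sigma$, $\inf_{t\ge t_0}\sigma_{\min}\ge\underline\sigma$ for constants $\bar\sigma,\underline\sigma$. Definitions: $p(t)=\frac{d}{dt}\ln\|W(t)\|$ (continuous), $k(t)=\|W(t)\|\,\|W^{-1}(t)\|$ (continuous and bounded). Nonlinear Lipschitz inequality: $\|f(t,x)\|\le L(t,\|x\|)$ for all $x\in\Omega$, $t\ge t_0$, where $\Omega$ is a neighborhood of $x=0$ and $L$ is continuous in $t$ and $\|x\|$; the solutions considered are those staying in $\Omega$ (automatic if $\Omega=\mathbb{R}^n$). The auxiliary equation $\dot X=p(t)X+k(t)L(t,X)+k(t)\|F(t)\|$ is assumed to have a unique solution for every initial value $X(t_0)=X_0\ge0$, for all $t\ge t_0$. Set $\hat p=\sup_{t\ge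 t_0}p(t)$, $\hat k=\sup_{t\ge t_0}k(t)$, $\hat L(X)=\sup_{t\ge t_0}L(t,X)$, $\hat F=\sup_{t\ge t_0}\|F(t)\|$; these are assumed finite, with $\hat L(0)=0$, and the scalar autonomous equation $\dot X=Q(X,\hat F)$ is assumed to have unique solutions, extendable to all $t\ge t_0$, for the relevant initial values. $\omega(t_0,d)=\{x_0\in\mathbb{R}^n:\|W^{-1}(t_0)x_0\|\le d\}$.
   Formalization: The limsup bound is proved assuming that $\hat L$ is continuous on $[0,d_1]$ and, when $n=1$, that $\|W^{-1}(t_0)x_0\|\ne d_1$; it can fail otherwise (e.g. for $n=1$, $x_0=d_1$ may be an equilibrium). *)

theory Defs
  imports "HOL-Analysis.Analysis"
begin

text \<open>The instance norm on \<open>real^'n^'m\<close> is the Frobenius norm; the matrix norm meant here is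
  the one induced by the Euclidean norm.\<close>

abbreviation spectral_norm :: "real^'n^'m \<Rightarrow> real" where
  "spectral_norm M \<equiv> onorm (\<lambda>v. M *v v)"

definition singular_values :: "real^'n^'n \<Rightarrow> real set" where
  "singular_values M =
     {s. 0 \<le> s \<and> (\<exists>v. v \<noteq> 0 \<and> (transpose M ** M) *v v = s\<^sup>2 *\<^sub>R v)}"

definition sigma_max :: "real^'n^'n \<Rightarrow> real" where
  "sigma_max M = Max (singular_values M)"

definition sigma_min :: "real^'n^'n \<Rightarrow> real" where
  "sigma_min M = Min (singular_values M)"

text \<open>The matrix \<open>transpose M ** M\<close> is symmetric, so the multiplicity of a singular value is the
  dimension of the eigenspace.\<close>

definition simple_sigma_max :: "real^'n^'n \<Rightarrow> bool" where
  "simple_sigma_max M \<longleftrightarrow>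
     dim {v. (transpose M ** M) *v v = (sigma_max M)\<^sup>2 *\<^sub>R v} = 1"

text \<open>Solutions on the time set \<open>J\<close> of an equation with state space \<open>D\<close>; derivatives at end points
  of \<open>J\<close> are one-sided.\<close>

definition solves_on ::
    "(real \<Rightarrow> 'a \<Rightarrow> 'a) \<Rightarrow> 'a set \<Rightarrow> real set \<Rightarrow> (real \<Rightarrow> 'a::real_normed_vector) \<Rightarrow> bool" where
  "solves_on g D J u \<longleftrightarrow>
     (\<forall>t\<in>J. u t \<in> D \<and> (u has_vector_derivative g t (u t)) (at t within J))"

text \<open>A solution exists on the whole half-line, and any two solutions, including those given only
  on a bounded interval, agree wherever both are defined.\<close>

definition unique_ivp ::
    "(real \<Rightarrow> 'a \<Rightarrow> 'a) \<Rightarrow> 'a set \<Rightarrow> real \<Rightarrow> 'a::real_normed_vector \<Rightarrow> bool" where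
  "unique_ivp g D t0 u0 \<longleftrightarrow>
     (\<exists>u. solves_on g D {t0..} u \<and> u t0 = u0) \<and>
     (\<forall>T\<ge>t0. \<forall>u v. solves_on g D {t0..T} u \<and> u t0 = u0 \<and>
                     solves_on g D {t0..T} v \<and> v t0 = u0 \<longrightarrow> u T = v T)"

text \<open>Lyapunov stability of the fixed solution \<open>c\<close> of an autonomous equation. Solutions on
  arbitrary bounded intervals are considered, so that a nearby solution escaping in finite time
  also violates stability.\<close>

definition stable_fixed_solution ::
    "('a \<Rightarrow> 'a) \<Rightarrow> 'a set \<Rightarrow> real \<Rightarrow> 'a::real_normed_vector \<Rightarrow> bool" where
  "stable_fixed_solution q D t0 c \<longleftrightarrow>
     (\<forall>e>0. \<exists>d>0. \<forall>T\<ge>t0. \<forall>u.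
        solves_on (\<lambda>_. q) D {t0..T} u \<and> norm (u t0 - c) < d \<longrightarrow> norm (u T - c) < e)"

definition omega_set :: "(real \<Rightarrow> real^'n^'n) \<Rightarrow> real \<Rightarrow> real \<Rightarrow> (real^'n) set" where
  "omega_set W t0 d = {x0. norm (matrix_inv (W t0) *v x0) \<le> d}"

end

theory Submission
  imports Defs "HOL-Complex_Analysis.Great_Picard"
begin

text \<open>
  Write \<open>x(t) = W(t) z(t)\<close> and follow the amplitude \<open>\<psi> = \<parallel>W\<parallel> \<cdot> \<parallel>z\<parallel>\<close>, which dominates \<open>u = \<parallel>x\<parallel>\<close> and
  starts at \<open>\<parallel>W\<^sup>-\<^sup>1(t0) x0\<parallel>\<close>. Its upper right derivative is at most \<open>p \<psi> + k \<parallel>f + F\<parallel>\<close>, hence at most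
  \<open>phat \<psi> + h(u)\<close> with \<open>h(u) = khat (Lhat(u) + Fhat)\<close>. The nonlinear term contains \<open>u\<close> rather than \<open>\<psi>\<close>,
  so while \<open>u \<le> \<rho>\<close> a linear Gronwall estimate makes \<open>\<psi>\<close> relax exponentially towards
  \<open>- h(\<rho>) / phat\<close>, and this level is below \<open>\<rho>\<close> exactly when \<open>Q(\<rho>) < 0\<close>. Monotonicity of \<open>Lhat\<close> is what
  allows \<open>h(u)\<close> to be replaced by \<open>h(\<rho>)\<close>.

  If \<open>Q(d) = 0\<close> and \<open>\<psi>\<close> starts strictly below \<open>d\<close>, this confines \<open>u\<close> below \<open>d\<close>. When \<open>\<psi>\<close> starts at \<open>d\<close>, the
  bound can only be lost at a time when \<open>u = \<psi> = d\<close>. The dimension decides how such a time is handled.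

  \<^item> In dimension at least two, a simple largest singular value keeps \<open>W\<close> from being a multiple of an
    isometry, so \<open>khat > 1\<close> (\<open>condition_number_gt_1\<close>). At a time with \<open>u = \<psi> = d\<close> the norm of \<open>x\<close> itself
    grows at most at the rate \<open>p d + \<parallel>f + F\<parallel>\<close>, without the factor \<open>k\<close>, and this is strictly below
    \<open>Q(d) = 0\<close>: the trajectory turns inwards (\<open>extremal_point_descends\<close>).

  \<^item> In dimension one, \<open>u = \<psi>\<close> at all times and \<open>u\<close> is a subsolution of the auxiliary equation, while the
    constant \<open>d\<close> is a supersolution. Unique solvability of that equation forces
    \<open>u \<le> y \<le> d\<close> for its solution \<open>y\<close>: Peano's theorem for right-hand sides clamped to a strip yields a
    solution above \<open>u\<close> and one below \<open>d\<close>, and both must be \<open>y\<close>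
    (\<open>subsolution_le_unique_ivp\<close>, \<open>unique_ivp_le_constant_supersolution\<close>).

  For the asymptotic bound, stability of \<open>d2\<close> makes \<open>Q\<close> negative between \<open>d2\<close> and \<open>d1\<close>
  (\<open>negative_above_stable_root\<close>), and the amplitude falls strictly below \<open>d1\<close> at some time. Each
  eventual bound \<open>\<rho>\<close> on \<open>u\<close> between \<open>d2\<close> and \<open>d1\<close> then improves to anything above \<open>- h(\<rho>) / phat < \<rho>\<close>, so by continuity of
  \<open>Lhat\<close> the infimum of the eventual bounds is \<open>d2\<close> (\<open>eventually_le_lower_root\<close>).
\<close>

section \<open>Upper right derivatives and differential inequalities\<close>

text \<open>An upper bound on the Dini derivative \<open>D\<^sup>+ \<phi>\<close>, needed because norms of trajectories and products
  with operator norms need not be differentiable. Stated through increments, it avoids limits superior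
  of difference quotients.\<close>
definition upper_right_deriv_le :: "(real \<Rightarrow> real) \<Rightarrow> real \<Rightarrow> real \<Rightarrow> bool" where
  "upper_right_deriv_le \<phi> t D \<longleftrightarrow>
     (\<forall>e>0. \<forall>\<^sub>F s in at_right t. \<phi> s \<le> \<phi> t + (D + e) * (s - t))"

lemma upper_right_deriv_le_mono:
  assumes "upper_right_deriv_le \<phi> t D" "D \<le> D'"
  shows "upper_right_deriv_le \<phi> t D'"
  unfolding upper_right_deriv_le_def
proof (intro allI impI)
  fix e :: real assume "e > 0"
  with assms have "\<forall>\<^sub>F s in at_right t. \<phi> s \<le> \<phi> t + (D + e) * (s - t)"
    by (auto simp: upper_right_deriv_le_def)
  then show "\<forall>\<^sub>F s in at_right t. \<phi> s \<le> \<phi> t + (D' + e) * (s - t)"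
    using eventually_at_right_less[of t]
  proof eventually_elim
    case (elim s)
    have "(D + e) * (s - t) \<le> (D' + e) * (s - t)"
      using elim assms(2) by (intro mult_right_mono) auto
    with elim show ?case by linarith
  qed
qed

lemma has_real_derivative_at_right_bounds:
  fixes \<beta> :: "real \<Rightarrow> real"
  assumes "(\<beta> has_real_derivative D) (at t within {t..})" "e > 0"
  shows "\<forall>\<^sub>F s in at_right t. \<beta> t + (D - e) * (s - t) \<le> \<beta> s \<and> \<beta> s \<le> \<beta> t + (D + e) * (s - t)"
proof -
  have "((\<lambda>s. (\<beta> s - \<beta> t) / (s - t)) \<longlongrightarrow> D) (at_right t)"
    using assms(1) by (simp add: has_field_derivative_iff at_within_Ici_at_right)
  then have "\<forall>\<^sub>F s in at_right t. dist ((\<beta> s - \<beta> t) / (s - t)) D < e"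
    using assms(2) by (rule tendstoD)
  then show ?thesis
    using eventually_at_right_less[of t]
  proof eventually_elim
    case (elim s)
    then have "(\<beta> s - \<beta> t) / (s - t) < D + e" "D - e < (\<beta> s - \<beta> t) / (s - t)"
      by (auto simp: dist_real_def)
    with elim show ?case by (auto simp: pos_divide_less_eq pos_less_divide_eq)
  qed
qed

lemma has_real_derivative_Icc_imp_Ici:
  assumes "(f has_real_derivative D) (at t within {a..b})" "a \<le> t" "t < b"
  shows "(f has_real_derivative D) (at t within {t..})"
proof -
  have "(f has_real_derivative D) (at t within {t..b})"
    using assms(1) by (rule DERIV_subset) (use assms in auto)
  then show ?thesis
    using \<open>t < b\<close> by (simp add: at_within_Icc_at_right at_within_Ici_at_right)
qed

lemma upper_right_deriv_le_majorant:
  assumes "(\<psi> has_real_derivative D) (at t within {t..})" "\<psi> t = \<phi> t"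
    and "\<forall>\<^sub>F s in at_right t. \<phi> s \<le> \<psi> s"
  shows "upper_right_deriv_le \<phi> t D"
  unfolding upper_right_deriv_le_def
proof (intro allI impI)
  fix e :: real assume "e > 0"
  from has_real_derivative_at_right_bounds[OF assms(1) this] assms(3)
  show "\<forall>\<^sub>F s in at_right t. \<phi> s \<le> \<phi> t + (D + e) * (s - t)"
    by eventually_elim (use assms(2) in auto)
qed

lemma has_real_derivative_imp_upper_right_deriv_le:
  assumes "(\<phi> has_real_derivative D) (at t within {t..})" "D \<le> D'"
  shows "upper_right_deriv_le \<phi> t D'"
  using upper_right_deriv_le_majorant[of \<phi> D t \<phi>] upper_right_deriv_le_mono assms by simp

lemma upper_right_deriv_le_diff:
  assumes "upper_right_deriv_le \<phi> t D" "(\<beta> has_real_derivative D') (at t within {t..})"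
  shows "upper_right_deriv_le (\<lambda>s. \<phi> s - \<beta> s) t (D - D')"
  unfolding upper_right_deriv_le_def
proof (intro allI impI)
  fix e :: real assume "e > 0"
  then have "\<forall>\<^sub>F s in at_right t. \<phi> s \<le> \<phi> t + (D + e/2) * (s - t)"
    using assms(1) by (auto simp: upper_right_deriv_le_def)
  moreover have "\<forall>\<^sub>F s in at_right t. \<beta> t + (D' - e/2) * (s - t) \<le> \<beta> s \<and> \<beta> s \<le> \<beta> t + (D' + e/2) * (s - t)"
    using has_real_derivative_at_right_bounds[OF assms(2)] \<open>e > 0\<close> by simp
  ultimately show "\<forall>\<^sub>F s in at_right t. \<phi> s - \<beta> s \<le> \<phi> t - \<beta> t + (D - D' + e) * (s - t)"
    by eventually_elim (simp add: algebra_simps diff_divide_distrib)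
qed

lemma upper_right_deriv_le_neg_imp_less:
  assumes "upper_right_deriv_le \<phi> t D" "D < 0"
  shows "\<forall>\<^sub>F s in at_right t. \<phi> s < \<phi> t"
proof -
  have "\<forall>\<^sub>F s in at_right t. \<phi> s \<le> \<phi> t + (D + - D / 2) * (s - t)"
    using assms unfolding upper_right_deriv_le_def by (elim allE[of _ "- D / 2"]) simp
  then show ?thesis
    using eventually_at_right_less[of t]
  proof eventually_elim
    case (elim s)
    have "(D + - D / 2) * (s - t) < 0" using elim \<open>D < 0\<close> by (intro mult_neg_pos) auto
    with elim show ?case by linarith
  qed
qed

lemma continuous_on_eventually_at_right_less:
  fixes \<phi> :: "real \<Rightarrow> real"
  assumes "continuous_on {a..b} \<phi>" "a \<le> t" "t < b" "\<phi> t < c"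
  shows "\<forall>\<^sub>F s in at_right t. \<phi> s < c"
proof -
  have "continuous_on {t..b} \<phi>"
    using assms by (auto intro: continuous_on_subset)
  then have "(\<phi> \<longlongrightarrow> \<phi> t) (at_right t)"
    using \<open>t < b\<close> by (rule continuous_on_Icc_at_rightD)
  then show ?thesis using \<open>\<phi> t < c\<close> by (rule order_tendstoD)
qed

text \<open>Induction along an interval: the set of times up to which \<open>\<phi> \<le> 0\<close> has held is closed by
  continuity and open to the right by the step hypothesis.\<close>
lemma nonpos_by_continuation:
  fixes \<phi> :: "real \<Rightarrow> real"
  assumes cont: "continuous_on {a..b} \<phi>" and init: "\<phi> a \<le> 0"
    and step: "\<And>\<tau>. \<lbrakk>a \<le> \<tau>; \<tau> < b; \<And>s. \<lbrakk>a \<le> s; s \<le> \<tau>\<rbrakk> \<Longrightarrow> \<phi> s \<le> 0\<rbrakk>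
                   \<Longrightarrow> \<forall>\<^sub>F s in at_right \<tau>. \<phi> s \<le> 0"
    and t: "a \<le> t" "t \<le> b"
  shows "\<phi> t \<le> 0"
proof (rule ccontr)
  assume pos: "\<not> \<phi> t \<le> 0"
  define S where "S = {r. a \<le> r \<and> r \<le> t \<and> (\<forall>s. a \<le> s \<and> s \<le> r \<longrightarrow> \<phi> s \<le> 0)}"
  define c where "c = Sup S"
  have aS: "a \<in> S" using init t by (auto simp: S_def)
  have bdd: "bdd_above S" by (auto simp: S_def)
  have "a \<le> c" unfolding c_def by (rule cSup_upper[OF aS bdd])
  moreover have "c \<le> t" unfolding c_def by (rule cSup_least) (use aS in \<open>auto simp: S_def\<close>)
  ultimately have c: "a \<le> c" "c \<le> t" .
  have before: "\<phi> s \<le> 0" if "a \<le> s" "s < c" for s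
    using less_cSupD[of S s] that aS by (fastforce simp: c_def S_def)
  have "\<phi> c \<le> 0"
  proof (rule ccontr)
    assume nc: "\<not> \<phi> c \<le> 0"
    have "c \<in> {a..b}" using c t by auto
    then obtain d where d: "d > 0" "\<And>s. s \<in> {a..b} \<Longrightarrow> dist s c < d \<Longrightarrow> dist (\<phi> s) (\<phi> c) < \<phi> c"
      using cont[unfolded continuous_on_iff, rule_format, of c "\<phi> c"] nc by force
    have "a < c" using nc init c by (cases "a = c") auto
    define s where "s = max a (c - d/2)"
    have s: "a \<le> s" "s < c" "dist s c < d" "s \<in> {a..b}"
      using d \<open>a < c\<close> c t by (auto simp: s_def dist_real_def)
    from d(2)[OF s(4,3)] before[OF s(1,2)] show False by (auto simp: dist_real_def)
  qed
  then have upto: "\<phi> s \<le> 0" if "a \<le> s" "s \<le> c" for s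
    using before that by (cases "s = c") auto
  have "c < t" using pos upto[of t] c t by (cases "c = t") auto
  then have "\<forall>\<^sub>F s in at_right c. \<phi> s \<le> 0"
    using step[of c] c t upto by auto
  then obtain r where r: "r > c" "\<And>s. c < s \<Longrightarrow> s < r \<Longrightarrow> \<phi> s \<le> 0"
    unfolding eventually_at_right_field by blast
  \<comment> \<open>a point beyond \<open>c\<close> up to which the bound still holds, contradicting the choice of \<open>c\<close>\<close>
  define w where "w = min t ((c + r)/2)"
  have w: "w > c" "w \<le> t" "w < r" using r \<open>c < t\<close> by (auto simp: w_def min_def)
  have "\<phi> s \<le> 0" if "a \<le> s" "s \<le> w" for s
    using upto[of s] r(2)[of s] that w by fastforce
  then have "w \<in> S" using w c by (auto simp: S_def)
  then have "w \<le> c" unfolding c_def using bdd by (rule cSup_upper)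
  with w show False by simp
qed

text \<open>It suffices to control the derivative where \<open>\<phi> \<ge> 0\<close>, since a continuous function can become
  positive only by first passing through such points. Comparing with \<open>e (s - a)\<close> turns the nonstrict
  hypothesis into a step that survives continuation.\<close>
lemma nonpos_if_upper_right_deriv_nonpos:
  fixes \<phi> :: "real \<Rightarrow> real"
  assumes cont: "continuous_on {a..b} \<phi>" and init: "\<phi> a \<le> 0"
    and deriv: "\<And>s. \<lbrakk>a \<le> s; s < b; \<phi> s \<ge> 0\<rbrakk> \<Longrightarrow> upper_right_deriv_le \<phi> s 0"
    and t: "a \<le> t" "t \<le> b"
  shows "\<phi> t \<le> 0"
proof (rule field_le_epsilon)
  fix e0 :: real assume "e0 > 0"
  define e where "e = e0 / (1 + (t - a))"
  have e: "e > 0" "e * (t - a) \<le> e0" using \<open>e0 > 0\<close> t by (auto simp: e_def field_simps)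
  have "\<phi> t - e * (t - a) \<le> 0"
  proof (rule nonpos_by_continuation[where a = a and b = b and \<phi> = "\<lambda>s. \<phi> s - e * (s - a)"])
    show "continuous_on {a..b} (\<lambda>s. \<phi> s - e * (s - a))"
      by (intro continuous_intros cont)
    fix \<tau> assume \<tau>: "a \<le> \<tau>" "\<tau> < b" and "\<And>s. \<lbrakk>a \<le> s; s \<le> \<tau>\<rbrakk> \<Longrightarrow> \<phi> s - e * (s - a) \<le> 0"
    then have le: "\<phi> \<tau> \<le> e * (\<tau> - a)" by force
    show "\<forall>\<^sub>F s in at_right \<tau>. \<phi> s - e * (s - a) \<le> 0"
    proof (cases "\<phi> \<tau> \<ge> 0")
      case True
      then have "\<forall>\<^sub>F s in at_right \<tau>. \<phi> s \<le> \<phi> \<tau> + (0 + e) * (s - \<tau>)"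
        using deriv[OF \<tau>] e by (auto simp: upper_right_deriv_le_def)
      then show ?thesis by eventually_elim (use le in \<open>auto simp: algebra_simps\<close>)
    next
      case False
      then have "\<forall>\<^sub>F s in at_right \<tau>. \<phi> s < 0"
        by (intro continuous_on_eventually_at_right_less[OF cont \<tau>]) simp
      then show ?thesis using eventually_at_right_less[of \<tau>]
      proof eventually_elim
        case (elim s)
        have "0 \<le> e * (s - a)" using e \<tau> elim by (intro mult_nonneg_nonneg) auto
        with elim show ?case by linarith
      qed
    qed
  qed (use init t in auto)
  with e show "\<phi> t \<le> 0 + e0" by linarith
qed

text \<open>The right-hand side solves \<open>\<beta>' = \<kappa> \<beta> + c\<close> with the same initial value. As \<open>\<kappa> < 0\<close>, the
  derivative bound for \<open>\<psi>\<close> is at most \<open>\<beta>'\<close> wherever \<open>\<psi> \<ge> \<beta>\<close>.\<close>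
lemma linear_Gronwall:
  fixes \<psi> :: "real \<Rightarrow> real"
  assumes cont: "continuous_on {a..b} \<psi>" and "\<kappa> < 0"
    and deriv: "\<And>s. \<lbrakk>a \<le> s; s < b\<rbrakk> \<Longrightarrow> upper_right_deriv_le \<psi> s (\<kappa> * \<psi> s + c)"
    and t: "a \<le> t" "t \<le> b"
  shows "\<psi> t \<le> - c / \<kappa> + (\<psi> a + c / \<kappa>) * exp (\<kappa> * (t - a))"
proof -
  define \<beta> where "\<beta> s = - c / \<kappa> + (\<psi> a + c / \<kappa>) * exp (\<kappa> * (s - a))" for s
  have \<beta>': "(\<beta> has_real_derivative \<kappa> * \<beta> s + c) (at s within A)" for s A
  proof -
    have "(\<beta> has_real_derivative (\<psi> a + c / \<kappa>) * (exp (\<kappa> * (s - a)) * \<kappa>)) (at s within A)"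
      unfolding \<beta>_def by (auto intro!: derivative_eq_intros)
    moreover have "(\<psi> a + c / \<kappa>) * (exp (\<kappa> * (s - a)) * \<kappa>) = \<kappa> * \<beta> s + c"
      using \<open>\<kappa> < 0\<close> by (simp add: \<beta>_def right_diff_distrib)
    ultimately show ?thesis by simp
  qed
  have "\<psi> t - \<beta> t \<le> 0"
  proof (rule nonpos_if_upper_right_deriv_nonpos[where a = a and b = b and \<phi> = "\<lambda>s. \<psi> s - \<beta> s"])
    show "continuous_on {a..b} (\<lambda>s. \<psi> s - \<beta> s)"
      by (intro continuous_on_diff cont DERIV_continuous_on[OF \<beta>'])
    fix s assume s: "a \<le> s" "s < b" "0 \<le> \<psi> s - \<beta> s"
    have d: "upper_right_deriv_le (\<lambda>s. \<psi> s - \<beta> s) s ((\<kappa> * \<psi> s + c) - (\<kappa> * \<beta> s + c))"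
      using deriv[OF s(1,2)] \<beta>' by (rule upper_right_deriv_le_diff)
    have "\<kappa> * \<psi> s \<le> \<kappa> * \<beta> s" using s \<open>\<kappa> < 0\<close> by simp
    then show "upper_right_deriv_le (\<lambda>s. \<psi> s - \<beta> s) s 0"
      using upper_right_deriv_le_mono[OF d] by simp
  next
    show "\<psi> a - \<beta> a \<le> 0" by (simp add: \<beta>_def)
  qed (use t in auto)
  then show ?thesis by (simp add: \<beta>_def)
qed

section \<open>Existence of solutions for bounded continuous right-hand sides\<close>

lemma continuous_on_along_curve:
  assumes "continuous_on (S \<times> D) (\<lambda>(t, y). G t y)"
    and "continuous_on T v" "T \<subseteq> S" "\<And>s. s \<in> T \<Longrightarrow> v s \<in> D"
  shows "continuous_on T (\<lambda>s. G s (v s))"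
proof -
  have "continuous_on T (\<lambda>s. (s, v s))" by (intro continuous_intros assms)
  then have "continuous_on T (\<lambda>s. (\<lambda>(t, y). G t y) (s, v s))"
    by (rule continuous_on_compose2[OF assms(1)]) (use assms in auto)
  then show ?thesis by simp
qed

text \<open>Tonelli's device: with a delay \<open>\<delta>\<close> in the argument, the integral equation is solved by finitely
  many iterations, because the \<open>j\<close>-th iterate no longer changes on \<open>[a, a + j \<delta>]\<close>.\<close>
lemma delayed_integral_equation:
  fixes H :: "real \<Rightarrow> 'a::euclidean_space \<Rightarrow> 'a"
  assumes cont: "continuous_on ({a..b} \<times> UNIV) (\<lambda>(t, y). H t y)" and "\<delta> > 0"
  obtains v where "continuous_on {a..b} v"
    and "\<And>t. t \<in> {a..b} \<Longrightarrow> v t = z0 + integral {a..t} (\<lambda>s. H s (v (max a (s - \<delta>))))"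
proof -
  define g where "g = rec_nat (\<lambda>_. z0)
      (\<lambda>_ (\<phi>::real \<Rightarrow> 'a) t. z0 + integral {a..t} (\<lambda>s. H s (\<phi> (max a (s - \<delta>)))))"
  have g_0: "g 0 t = z0" for t by (simp add: g_def)
  have g_Suc: "g (Suc j) t = z0 + integral {a..t} (\<lambda>s. H s (g j (max a (s - \<delta>))))" for j t
    by (simp add: g_def)
  have delayed: "max a (s - \<delta>) \<in> {a..b}" if "s \<in> {a..b}" for s
    using that \<open>\<delta> > 0\<close> by auto
  have g_cont: "continuous_on {a..b} (g j)" for j
  proof (induction j)
    case 0
    show ?case by (simp add: g_0)
  next
    case (Suc j)
    have "continuous_on {a..b} (\<lambda>s. g j (max a (s - \<delta>)))"
      by (rule continuous_on_compose2[OF Suc]) (use delayed in \<open>auto intro!: continuous_intros\<close>)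
    then have "continuous_on {a..b} (\<lambda>s. H s (g j (max a (s - \<delta>))))"
      by (rule continuous_on_along_curve[OF cont]) auto
    then have "continuous_on {a..b} (\<lambda>t. integral {a..t} (\<lambda>s. H s (g j (max a (s - \<delta>)))))"
      by (intro indefinite_integral_continuous_1 integrable_continuous_interval)
    then show ?case unfolding g_Suc by (intro continuous_intros)
  qed
  have stable: "g (Suc j) t = g j t" if "t \<in> {a..b}" "t \<le> a + real j * \<delta>" for j t
    using that
  proof (induction j arbitrary: t)
    case 0
    then show ?case by (simp add: g_Suc g_0)
  next
    case (Suc j)
    have "integral {a..t} (\<lambda>s. H s (g (Suc j) (max a (s - \<delta>)))) =
          integral {a..t} (\<lambda>s. H s (g j (max a (s - \<delta>))))"
    proof (rule integral_cong)
      fix s assume s: "s \<in> {a..t}"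
      have "max a (s - \<delta>) \<le> a + real j * \<delta>"
        using s Suc.prems \<open>\<delta> > 0\<close> by (auto simp: algebra_simps)
      then show "H s (g (Suc j) (max a (s - \<delta>))) = H s (g j (max a (s - \<delta>)))"
        using Suc.IH delayed[of s] s Suc.prems by simp
    qed
    then show ?case by (simp only: g_Suc)
  qed
  obtain N where N: "b - a < real N * \<delta>"
    using reals_Archimedean3[OF \<open>\<delta> > 0\<close>] by blast
  show ?thesis
  proof (rule that[of "g N"])
    show "continuous_on {a..b} (g N)" by (rule g_cont)
    fix t assume "t \<in> {a..b}"
    then show "g N t = z0 + integral {a..t} (\<lambda>s. H s (g N (max a (s - \<delta>))))"
      using stable[of t N] N by (simp add: g_Suc)
  qed
qed

text \<open>The solutions of the equations with delays \<open>1 / (n + 1)\<close> are uniformly bounded and share the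
  Lipschitz constant \<open>B\<close>. A uniform limit of a subsequence solves the undelayed integral equation, by
  dominated convergence.\<close>
theorem Peano_bounded:
  fixes H :: "real \<Rightarrow> 'a::euclidean_space \<Rightarrow> 'a"
  assumes "a \<le> b" and cont: "continuous_on ({a..b} \<times> UNIV) (\<lambda>(t, y). H t y)"
    and bound: "\<And>t y. t \<in> {a..b} \<Longrightarrow> norm (H t y) \<le> B"
  obtains z where "z a = z0"
    and "\<And>t. t \<in> {a..b} \<Longrightarrow> (z has_vector_derivative H t (z t)) (at t within {a..b})"
proof -
  have cont_along: "continuous_on {a..b} (\<lambda>s. H s (v s))" if "continuous_on {a..b} v" for v
    by (rule continuous_on_along_curve[OF cont that]) auto
  define \<delta> where "\<delta> n = inverse (real (Suc n))" for n
  have \<delta>_pos: "\<delta> n > 0" for n by (simp add: \<delta>_def)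
  have "\<exists>v. continuous_on {a..b} v \<and>
      (\<forall>t\<in>{a..b}. v t = z0 + integral {a..t} (\<lambda>s. H s (v (max a (s - \<delta> n)))))" for n
    using delayed_integral_equation[OF cont \<delta>_pos[of n], of z0] by metis
  then obtain v where v_cont: "\<And>n. continuous_on {a..b} (v n)"
    and v_eq: "\<And>n t. t \<in> {a..b} \<Longrightarrow>
                 v n t = z0 + integral {a..t} (\<lambda>s. H s (v n (max a (s - \<delta> n))))"
    by metis
  have delayed: "max a (s - \<delta> n) \<in> {a..b}" if "s \<in> {a..b}" for s n
    using that \<delta>_pos[of n] by auto
  have H_cont: "continuous_on {a..b} (\<lambda>s. H s (v n (max a (s - \<delta> n))))" for n
    by (rule cont_along, rule continuous_on_compose2[OF v_cont[of n]])
      (use delayed in \<open>auto intro!: continuous_intros\<close>)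
  have lip: "norm (v n t - v n s) \<le> B * (t - s)" if "a \<le> s" "s \<le> t" "t \<le> b" for n s t
  proof -
    let ?h = "\<lambda>s. H s (v n (max a (s - \<delta> n)))"
    have "integral {a..s} ?h + integral {s..t} ?h = integral {a..t} ?h"
      by (intro Henstock_Kurzweil_Integration.integral_combine integrable_continuous_interval
          continuous_on_subset[OF H_cont]) (use that in auto)
    then have "v n t - v n s = integral {s..t} ?h"
      using v_eq[of t n] v_eq[of s n] that by (simp add: algebra_simps)
    also have "norm \<dots> \<le> B * (t - s)"
      by (intro integral_bound continuous_on_subset[OF H_cont]) (use that bound in auto)
    finally show ?thesis .
  qed
  have lip': "norm (v n t - v n s) \<le> B * \<bar>t - s\<bar>" if "s \<in> {a..b}" "t \<in> {a..b}" for n s t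
    using lip[of s t n] lip[of t s n] that by (cases "s \<le> t") (auto simp: norm_minus_commute)
  have "B \<ge> 0" using order_trans[OF norm_ge_zero bound[of a 0]] \<open>a \<le> b\<close> by simp
  obtain z k where z_cont: "continuous_on {a..b} z" and k: "strict_mono (k :: nat \<Rightarrow> nat)"
    and conv: "\<And>e. 0 < e \<Longrightarrow> \<exists>N. \<forall>n t. n \<ge> N \<and> t \<in> {a..b} \<longrightarrow> norm (v (k n) t - z t) < e"
  proof (rule Arzela_Ascoli[of "{a..b}" v "norm z0 + B * (b - a)"])
    fix n t assume t: "t \<in> {a..b}"
    have "v n a = z0" using v_eq[of a n] \<open>a \<le> b\<close> by simp
    then have "norm (v n t) \<le> norm z0 + norm (v n t - v n a)"
      using norm_triangle_sub[of "v n t" "v n a"] by simp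
    also have "norm (v n t - v n a) \<le> B * (t - a)" using lip[of a t n] t by simp
    also have "\<dots> \<le> B * (b - a)" using t \<open>B \<ge> 0\<close> by (intro mult_left_mono) auto
    finally show "norm (v n t) \<le> norm z0 + B * (b - a)" by simp
  next
    fix t e :: real assume t: "t \<in> {a..b}" "0 < e"
    show "\<exists>d>0. \<forall>n y. y \<in> {a..b} \<and> norm (t - y) < d \<longrightarrow> norm (v n t - v n y) < e"
    proof (intro exI[of _ "e / (B + 1)"] conjI allI impI)
      show "0 < e / (B + 1)" using t \<open>B \<ge> 0\<close> by simp
      fix n y assume y: "y \<in> {a..b} \<and> norm (t - y) < e / (B + 1)"
      have "norm (v n t - v n y) \<le> B * \<bar>t - y\<bar>" using lip'[of y t n] t y by simp
      also have "\<dots> \<le> (B + 1) * \<bar>t - y\<bar>" by (intro mult_right_mono) auto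
      also have "\<dots> < e" using y \<open>B \<ge> 0\<close> by (simp add: field_simps)
      finally show "norm (v n t - v n y) < e" .
    qed
  qed auto
  have lim: "(\<lambda>n. v (k n) t) \<longlonglongrightarrow> z t" if "t \<in> {a..b}" for t
    unfolding tendsto_iff dist_norm eventually_sequentially using conv that by meson
  have delta_lim: "(\<lambda>n. \<delta> (k n)) \<longlonglongrightarrow> 0"
    using LIMSEQ_subseq_LIMSEQ[OF LIMSEQ_inverse_real_of_nat k] by (simp add: o_def \<delta>_def)
  have lim_delayed: "(\<lambda>n. v (k n) (max a (s - \<delta> (k n)))) \<longlonglongrightarrow> z s" if s: "s \<in> {a..b}" for s
  proof -
    have "(\<lambda>n. v (k n) (max a (s - \<delta> (k n))) - v (k n) s) \<longlonglongrightarrow> 0"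
    proof (rule Lim_null_comparison)
      show "\<forall>\<^sub>F n in sequentially. norm (v (k n) (max a (s - \<delta> (k n))) - v (k n) s) \<le> B * \<delta> (k n)"
      proof (intro always_eventually allI)
        fix n
        have "norm (v (k n) (max a (s - \<delta> (k n))) - v (k n) s) \<le> B * \<bar>max a (s - \<delta> (k n)) - s\<bar>"
          by (rule lip'[OF s delayed[OF s]])
        also have "\<dots> \<le> B * \<delta> (k n)"
          using \<open>B \<ge> 0\<close> \<delta>_pos[of "k n"] s by (intro mult_left_mono) auto
        finally show "norm (v (k n) (max a (s - \<delta> (k n))) - v (k n) s) \<le> B * \<delta> (k n)" .
      qed
      show "(\<lambda>n. B * \<delta> (k n)) \<longlonglongrightarrow> 0" using tendsto_mult_right_zero[OF delta_lim] .
    qed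
    from tendsto_add[OF this lim[OF s]] show ?thesis by simp
  qed
  have z_eq: "z t = z0 + integral {a..t} (\<lambda>s. H s (z s))" if t: "t \<in> {a..b}" for t
  proof -
    have "(\<lambda>n. integral {a..t} (\<lambda>s. H s (v (k n) (max a (s - \<delta> (k n))))))
            \<longlonglongrightarrow> integral {a..t} (\<lambda>s. H s (z s))"
    proof (rule dominated_convergence(2)[where h = "\<lambda>_. B"])
      fix n
      show "(\<lambda>s. H s (v (k n) (max a (s - \<delta> (k n))))) integrable_on {a..t}"
        by (intro integrable_continuous_interval continuous_on_subset[OF H_cont]) (use t in auto)
    next
      show "(\<lambda>_. B) integrable_on {a..t}" by (rule integrable_const_ivl)
    next
      fix n s assume "s \<in> {a..t}"
      then show "norm (H s (v (k n) (max a (s - \<delta> (k n))))) \<le> B" using t bound by simp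
    next
      fix s assume s: "s \<in> {a..t}"
      then have s': "s \<in> {a..b}" using t by simp
      have "continuous_on UNIV (\<lambda>y. H s y)"
        using continuous_on_compose2[OF cont, of UNIV "\<lambda>y. (s, y)"] s'
        by (auto simp: continuous_on_Pair image_subset_iff)
      then show "(\<lambda>n. H s (v (k n) (max a (s - \<delta> (k n))))) \<longlonglongrightarrow> H s (z s)"
        by (rule continuous_on_tendsto_compose) (use lim_delayed[OF s'] in auto)
    qed
    then have "(\<lambda>n. v (k n) t) \<longlonglongrightarrow> z0 + integral {a..t} (\<lambda>s. H s (z s))"
      unfolding v_eq[OF t] by (intro tendsto_intros)
    with lim[OF t] show ?thesis by (rule LIMSEQ_unique)
  qed
  show ?thesis
  proof (rule that[of z])
    show "z a = z0" using z_eq[of a] \<open>a \<le> b\<close> by simp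
    fix t assume t: "t \<in> {a..b}"
    have "((\<lambda>t. z0 + integral {a..t} (\<lambda>s. H s (z s))) has_vector_derivative 0 + H t (z t)) (at t within {a..b})"
      by (intro has_vector_derivative_add has_vector_derivative_const
          integral_has_vector_derivative cont_along z_cont t)
    then show "(z has_vector_derivative H t (z t)) (at t within {a..b})"
      using has_vector_derivative_transform[OF t z_eq] by simp
  qed
qed

section \<open>Comparison with uniquely solvable scalar equations\<close>

text \<open>Clamping the state to the strip between \<open>lo\<close> and \<open>hi\<close> makes the right-hand side bounded. As long
  as the solution stays in the strip, it solves the original equation; choosing the strip well is
  what turns existence into a comparison principle.\<close>
lemma clamped_solution:
  fixes G :: "real \<Rightarrow> real \<Rightarrow> real"
  assumes "a \<le> b" and G_cont: "continuous_on ({a..b} \<times> {0..}) (\<lambda>(t, y). G t y)"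
    and lo_cont: "continuous_on {a..b} lo" and hi_cont: "continuous_on {a..b} hi"
    and lo: "\<And>t. t \<in> {a..b} \<Longrightarrow> 0 \<le> lo t" and lohi: "\<And>t. t \<in> {a..b} \<Longrightarrow> lo t \<le> hi t"
  shows "\<exists>z. z a = z0 \<and> (\<forall>t\<in>{a..b}.
           (z has_real_derivative G t (max (lo t) (min (hi t) (z t)))) (at t within {a..b}))"
proof -
  define H where "H t y = G t (max (lo t) (min (hi t) y))" for t y
  have "continuous_on ({a..b} \<times> UNIV) (\<lambda>p. (fst p, max (lo (fst p)) (min (hi (fst p)) (snd p))))"
    by (intro continuous_intros continuous_on_compose2[OF lo_cont] continuous_on_compose2[OF hi_cont])
      auto
  then have "continuous_on ({a..b} \<times> UNIV)
      (\<lambda>p. (\<lambda>(t, y). G t y) (fst p, max (lo (fst p)) (min (hi (fst p)) (snd p))))"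
    by (rule continuous_on_compose2[OF G_cont]) (use lo in \<open>auto simp: le_max_iff_disj\<close>)
  then have H_cont: "continuous_on ({a..b} \<times> UNIV) (\<lambda>(t, y). H t y)"
    by (simp add: H_def case_prod_unfold)
  have "compact (hi ` {a..b})" by (intro compact_continuous_image hi_cont) auto
  then have "bdd_above (hi ` {a..b})" by (intro bounded_imp_bdd_above compact_imp_bounded)
  then obtain M where "\<forall>w\<in>hi ` {a..b}. w \<le> M" unfolding bdd_above_def by blast
  then have M: "hi t \<le> M" if "t \<in> {a..b}" for t using that by blast
  have "compact ((\<lambda>(t, y). G t y) ` ({a..b} \<times> {0..M}))"
    by (intro compact_continuous_image continuous_on_subset[OF G_cont] compact_Times) auto
  then have "bounded ((\<lambda>(t, y). G t y) ` ({a..b} \<times> {0..M}))" by (rule compact_imp_bounded)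
  then obtain B where "\<forall>w\<in>(\<lambda>(t, y). G t y) ` ({a..b} \<times> {0..M}). norm w \<le> B"
    unfolding bounded_iff by blast
  then have B: "norm (G t y) \<le> B" if "t \<in> {a..b}" "y \<in> {0..M}" for t y
    using that by blast
  have "norm (H t y) \<le> B" if t: "t \<in> {a..b}" for t y
    unfolding H_def using lo[OF t] lohi[OF t] M[OF t] by (intro B t) auto
  then obtain z where "z a = z0"
    "\<And>t. t \<in> {a..b} \<Longrightarrow> (z has_vector_derivative H t (z t)) (at t within {a..b})"
    using Peano_bounded[OF \<open>a \<le> b\<close> H_cont, of B z0] by metis
  then show ?thesis
    by (intro exI[of _ z]) (simp add: H_def has_real_derivative_iff_has_vector_derivative)
qed

text \<open>A right-hand side that need not be Lipschitz could have several solutions, some of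
  which cross the constant supersolution \<open>d\<close>. The equation clamped to \<open>[0, d]\<close> has a solution that stays
  in \<open>[0, d]\<close>, so it solves the original equation, and uniqueness identifies it with \<open>y\<close>.\<close>
lemma unique_ivp_le_constant_supersolution:
  fixes G :: "real \<Rightarrow> real \<Rightarrow> real"
  assumes "a \<le> b" and G_cont: "continuous_on ({a..b} \<times> {0..}) (\<lambda>(t, y). G t y)"
    and uniq: "unique_ivp G {0..} a (y a)" and y: "solves_on G {0..} {a..b} y"
    and "0 \<le> y a" "y a \<le> d"
    and G_0: "\<And>t. t \<in> {a..b} \<Longrightarrow> 0 \<le> G t 0" and G_d: "\<And>t. t \<in> {a..b} \<Longrightarrow> G t d \<le> 0"
  shows "y b \<le> d"
proof -
  have "0 \<le> d" using assms by simp
  have "\<exists>z. z a = y a \<and> (\<forall>t\<in>{a..b}.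
      (z has_real_derivative G t (max 0 (min d (z t)))) (at t within {a..b}))"
    by (rule clamped_solution[OF \<open>a \<le> b\<close> G_cont]) (use \<open>0 \<le> d\<close> in auto)
  then obtain z where za: "z a = y a" and z: "\<And>t. t \<in> {a..b} \<Longrightarrow>
      (z has_real_derivative G t (max 0 (min d (z t)))) (at t within {a..b})"
    by blast
  have z_cont: "continuous_on {a..b} z"
    by (rule DERIV_continuous_on[OF z])
  have below: "z t \<le> d" and above: "0 \<le> z t" if t: "a \<le> t" "t \<le> b" for t
  proof -
    have right: "(z has_real_derivative G s (max 0 (min d (z s)))) (at s within {s..})"
      if "a \<le> s" "s < b" for s
      using has_real_derivative_Icc_imp_Ici[OF z] that by simp
    have "z t - d \<le> 0"
    proof (rule nonpos_if_upper_right_deriv_nonpos[where \<phi> = "\<lambda>s. z s - d" and a = a and b = b])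
      fix s assume s: "a \<le> s" "s < b" "0 \<le> z s - d"
      have "((\<lambda>s. z s - d) has_real_derivative G s d) (at s within {s..})"
        using right[OF s(1,2)] s \<open>0 \<le> d\<close> by (auto intro!: derivative_eq_intros)
      then show "upper_right_deriv_le (\<lambda>s. z s - d) s 0"
        by (rule has_real_derivative_imp_upper_right_deriv_le) (use G_d s in auto)
    qed (use t za assms in \<open>auto intro!: continuous_intros z_cont\<close>)
    then show "z t \<le> d" by simp
    have "- z t \<le> 0"
    proof (rule nonpos_if_upper_right_deriv_nonpos[where \<phi> = "\<lambda>s. - z s" and a = a and b = b])
      fix s assume s: "a \<le> s" "s < b" "0 \<le> - z s"
      then have "max 0 (min d (z s)) = 0" using \<open>0 \<le> d\<close> by auto
      then have "((\<lambda>s. - z s) has_real_derivative - G s 0) (at s within {s..})"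
        using DERIV_minus[OF right[OF s(1,2)]] by simp
      then show "upper_right_deriv_le (\<lambda>s. - z s) s 0"
        by (rule has_real_derivative_imp_upper_right_deriv_le) (use G_0 s in auto)
    qed (use t za assms in \<open>auto intro!: continuous_intros z_cont\<close>)
    then show "0 \<le> z t" by simp
  qed
  have "solves_on G {0..} {a..b} z"
    unfolding solves_on_def
  proof (intro ballI conjI)
    fix t assume t: "t \<in> {a..b}"
    have "max 0 (min d (z t)) = z t" using below above t by simp
    then show "(z has_vector_derivative G t (z t)) (at t within {a..b})"
      using z[OF t] by (simp add: has_real_derivative_iff_has_vector_derivative)
  qed (use above in auto)
  then have "y b = z b"
    using uniq y za \<open>a \<le> b\<close> unfolding unique_ivp_def by blast
  then show ?thesis using below[of b] \<open>a \<le> b\<close> by simp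
qed

text \<open>Here the strip is bounded below by \<open>u\<close>, so that the clamped solution \<open>z\<close> stays above \<open>u\<close>. The upper
  edge lies one unit above both \<open>u\<close> and \<open>y\<close>; before \<open>z\<close> could reach it, \<open>z\<close> solves the original equation
  and equals \<open>y\<close>, which is a unit away from that edge.\<close>
lemma subsolution_le_unique_ivp:
  fixes G :: "real \<Rightarrow> real \<Rightarrow> real"
  assumes "a \<le> b" and G_cont: "continuous_on ({a..b} \<times> {0..}) (\<lambda>(t, y). G t y)"
    and uniq: "unique_ivp G {0..} a (y a)" and y: "solves_on G {0..} {a..b} y"
    and u_cont: "continuous_on {a..b} u" and u_nonneg: "\<And>t. t \<in> {a..b} \<Longrightarrow> 0 \<le> u t"
    and init: "u a \<le> y a"
    and sub: "\<And>t. \<lbrakk>a \<le> t; t < b\<rbrakk> \<Longrightarrow> upper_right_deriv_le u t (G t (u t))"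
  shows "u b \<le> y b"
proof -
  define hi where "hi t = max (u t) (y t) + 1" for t
  have y_cont: "continuous_on {a..b} y"
    using y by (auto simp: solves_on_def intro: continuous_on_vector_derivative)
  have hi_cont: "continuous_on {a..b} hi"
    unfolding hi_def by (intro continuous_intros u_cont y_cont)
  have "\<exists>z. z a = y a \<and> (\<forall>t\<in>{a..b}.
      (z has_real_derivative G t (max (u t) (min (hi t) (z t)))) (at t within {a..b}))"
    by (rule clamped_solution[OF \<open>a \<le> b\<close> G_cont u_cont hi_cont])
      (use u_nonneg in \<open>auto simp: hi_def\<close>)
  then obtain z where za: "z a = y a" and z: "\<And>t. t \<in> {a..b} \<Longrightarrow>
      (z has_real_derivative G t (max (u t) (min (hi t) (z t)))) (at t within {a..b})"
    by blast
  have z_cont: "continuous_on {a..b} z"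
    by (rule DERIV_continuous_on[OF z])
  have above: "u t \<le> z t" if t: "a \<le> t" "t \<le> b" for t
  proof -
    have "u t - z t \<le> 0"
    proof (rule nonpos_if_upper_right_deriv_nonpos[where \<phi> = "\<lambda>s. u s - z s" and a = a and b = b])
      fix s assume s: "a \<le> s" "s < b" "0 \<le> u s - z s"
      then have clamp: "max (u s) (min (hi s) (z s)) = u s" by (auto simp: hi_def)
      have "(z has_real_derivative G s (u s)) (at s within {s..})"
        using has_real_derivative_Icc_imp_Ici[OF z[of s]] s unfolding clamp by simp
      from upper_right_deriv_le_diff[OF sub[OF s(1,2)] this]
      show "upper_right_deriv_le (\<lambda>s. u s - z s) s 0" by simp
    qed (use t za init in \<open>auto intro!: continuous_intros z_cont u_cont\<close>)
    then show ?thesis by simp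
  qed
  have agree: "z \<tau> = y \<tau>" if \<tau>: "a \<le> \<tau>" "\<tau> \<le> b" and le: "\<And>s. \<lbrakk>a \<le> s; s \<le> \<tau>\<rbrakk> \<Longrightarrow> z s \<le> hi s" for \<tau>
  proof -
    have "solves_on G {0..} {a..\<tau>} z"
      unfolding solves_on_def
    proof (intro ballI conjI)
      fix t assume t: "t \<in> {a..\<tau>}"
      have "max (u t) (min (hi t) (z t)) = z t" using le above t \<tau> by simp
      then have "(z has_real_derivative G t (z t)) (at t within {a..b})"
        using z[of t] t \<tau> by simp
      then have "(z has_real_derivative G t (z t)) (at t within {a..\<tau>})"
        by (rule DERIV_subset) (use \<tau> in auto)
      then show "(z has_vector_derivative G t (z t)) (at t within {a..\<tau>})"
        by (simp add: has_real_derivative_iff_has_vector_derivative)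
      show "z t \<in> {0..}" using above[of t] u_nonneg[of t] t \<tau> by simp
    qed
    moreover have "solves_on G {0..} {a..\<tau>} y"
      using y \<tau> has_vector_derivative_within_subset[of y _ _ "{a..b}" "{a..\<tau>}"]
      unfolding solves_on_def by auto
    ultimately show ?thesis
      using uniq za \<tau> unfolding unique_ivp_def by blast
  qed
  have "z t - hi t \<le> 0" if t: "a \<le> t" "t \<le> b" for t
  proof (rule nonpos_by_continuation[where \<phi> = "\<lambda>s. z s - hi s" and a = a and b = b])
    show cont: "continuous_on {a..b} (\<lambda>s. z s - hi s)" by (intro continuous_intros z_cont hi_cont)
    fix \<tau> assume \<tau>: "a \<le> \<tau>" "\<tau> < b" and "\<And>s. \<lbrakk>a \<le> s; s \<le> \<tau>\<rbrakk> \<Longrightarrow> z s - hi s \<le> 0"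
    then have "z \<tau> = y \<tau>" using agree[of \<tau>] by force
    then have neg: "z \<tau> - hi \<tau> < 0" by (simp add: hi_def)
    from continuous_on_eventually_at_right_less[OF cont \<tau> neg]
    show "\<forall>\<^sub>F s in at_right \<tau>. z s - hi s \<le> 0" by eventually_elim simp
  qed (use t za in \<open>auto simp: hi_def\<close>)
  then have "z b = y b" using agree[of b] \<open>a \<le> b\<close> by force
  then show ?thesis using above[of b] \<open>a \<le> b\<close> by simp
qed

section \<open>The spectral norm and the condition number\<close>

lemma norm_matrix_vector_le_spectral:
  fixes M :: "real^'n^'m"
  shows "norm (M *v v) \<le> spectral_norm M * norm v"
  by (rule onorm) (rule matrix_vector_mul_bounded_linear)

lemma spectral_norm_nonneg:
  fixes M :: "real^'n^'m"
  shows "0 \<le> spectral_norm M"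
  by (rule onorm_pos_le) (rule matrix_vector_mul_bounded_linear)

lemma bounded_linear_matrix_apply:
  fixes v :: "real^'n"
  shows "bounded_linear (\<lambda>M :: real^'n^'m. M *v v)"
  unfolding linear_conv_bounded_linear[symmetric]
  by (intro linearI) (simp_all add: matrix_vector_mult_add_rdistrib scaleR_matrix_vector_assoc)

lemma matrix_inv_mult_vector:
  fixes M :: "real^'n^'n"
  assumes "invertible M"
  shows "M *v (matrix_inv M *v v) = v" "matrix_inv M *v (M *v v) = v"
proof -
  have "M ** matrix_inv M = mat 1 \<and> matrix_inv M ** M = mat 1"
    using assms unfolding invertible_def matrix_inv_def by (rule someI_ex)
  then show "M *v (matrix_inv M *v v) = v" "matrix_inv M *v (M *v v) = v"
    by (simp_all add: matrix_vector_mul_assoc)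
qed

lemma condition_number_ge_1:
  fixes M :: "real^'n^'n"
  assumes "invertible M"
  shows "1 \<le> spectral_norm M * spectral_norm (matrix_inv M)"
proof -
  obtain v :: "real^'n" where v: "norm v = 1" using vector_choose_size[of 1] by auto
  have "norm v = norm (M *v (matrix_inv M *v v))" by (simp add: matrix_inv_mult_vector[OF assms])
  also have "\<dots> \<le> spectral_norm M * norm (matrix_inv M *v v)"
    by (rule norm_matrix_vector_le_spectral)
  also have "\<dots> \<le> spectral_norm M * (spectral_norm (matrix_inv M) * norm v)"
    by (intro mult_left_mono norm_matrix_vector_le_spectral spectral_norm_nonneg)
  finally show ?thesis by (simp add: v)
qed

lemma spectral_norm_pos:
  fixes M :: "real^'n^'n"
  assumes "invertible M"
  shows "0 < spectral_norm M"
  using condition_number_ge_1[OF assms] spectral_norm_nonneg[of M]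
  by (cases "spectral_norm M = 0") auto

text \<open>By polarization \<open>M\<close> scales inner products by \<open>c\<^sup>2\<close>, so every vector is an eigenvector of
  \<open>transpose M ** M\<close> and the eigenspace of the only singular value is everything.\<close>
lemma similarity_not_simple_sigma_max:
  fixes M :: "real^'n^'n"
  assumes "CARD('n) \<noteq> 1" "0 \<le> c" and sim: "\<And>v. norm (M *v v) = c * norm v"
  shows "\<not> simple_sigma_max M"
proof -
  have inner: "inner (M *v v) (M *v w) = c\<^sup>2 * inner v w" for v w
    unfolding dot_norm matrix_vector_right_distrib[symmetric] sim
    by (simp add: power_mult_distrib algebra_simps)
  have eig: "(transpose M ** M) *v v = c\<^sup>2 *\<^sub>R v" for v
  proof -
    have "inner ((transpose M ** M) *v v) w = inner (c\<^sup>2 *\<^sub>R v) w" for w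
    proof -
      have "inner ((transpose M ** M) *v v) w = inner ((M *v v) v* M) w"
        by (simp only: matrix_vector_mul_assoc[symmetric] transpose_matrix_vector)
      also have "\<dots> = inner (M *v v) (M *v w)" by (rule dot_lmul_matrix)
      finally show ?thesis by (simp add: inner)
    qed
    then show ?thesis using vector_eq_rdot by blast
  qed
  obtain v0 :: "real^'n" where v0: "norm v0 = 1" using vector_choose_size[of 1] by auto
  have "s = c" if "0 \<le> s" "v \<noteq> 0" "(transpose M ** M) *v v = s\<^sup>2 *\<^sub>R v" for s v
    using that eig[of v] \<open>0 \<le> c\<close> by auto
  moreover have "v0 \<noteq> 0" using v0 by auto
  ultimately have "singular_values M = {c}"
    using eig \<open>0 \<le> c\<close> unfolding singular_values_def by auto
  then have "sigma_max M = c" by (simp add: sigma_max_def)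
  then have "dim {v. (transpose M ** M) *v v = (sigma_max M)\<^sup>2 *\<^sub>R v} = CARD('n)"
    by (simp add: eig)
  with assms(1) show ?thesis unfolding simple_sigma_max_def by simp
qed

text \<open>Equality in \<open>1 \<le> \<parallel>M\<parallel> \<parallel>M\<^sup>-\<^sup>1\<parallel>\<close> would make \<open>M\<close> a multiple of an isometry. This is where simplicity of
  the largest singular value enters.\<close>
lemma condition_number_gt_1:
  fixes M :: "real^'n^'n"
  assumes "invertible M" "simple_sigma_max M" "CARD('n) \<noteq> 1"
  shows "1 < spectral_norm M * spectral_norm (matrix_inv M)"
proof (rule ccontr)
  assume "\<not> ?thesis"
  then have eq: "spectral_norm M * spectral_norm (matrix_inv M) = 1"
    using condition_number_ge_1[OF assms(1)] by simp
  have "norm (M *v v) = spectral_norm M * norm v" for v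
  proof (rule antisym)
    have "norm v = norm (matrix_inv M *v (M *v v))" by (simp add: matrix_inv_mult_vector[OF assms(1)])
    also have "\<dots> \<le> spectral_norm (matrix_inv M) * norm (M *v v)"
      by (rule norm_matrix_vector_le_spectral)
    finally have "spectral_norm M * norm v \<le> spectral_norm M * (spectral_norm (matrix_inv M) * norm (M *v v))"
      by (intro mult_left_mono spectral_norm_nonneg)
    then show "spectral_norm M * norm v \<le> norm (M *v v)" using eq by (simp add: mult.assoc[symmetric])
  qed (rule norm_matrix_vector_le_spectral)
  from similarity_not_simple_sigma_max[OF assms(3) spectral_norm_nonneg this] assms(2)
  show False by simp
qed

lemma norm_matrix_vector_one_dim:
  fixes M :: "real^'n^'n"
  assumes "CARD('n) = 1"
  shows "norm (M *v v) = spectral_norm M * norm v"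
proof (cases "v = 0")
  case False
  obtain i :: 'n where i: "UNIV = {i}" using assms by (auto simp: card_1_singleton_iff)
  have all: "j = i" for j using i by blast
  have "v $ i \<noteq> 0" using False by (metis all vec_eq_iff zero_index)
  have "spectral_norm M \<le> norm (M *v v) / norm v"
  proof (rule onorm_le)
    fix w :: "real^'n"
    define c where "c = w $ i / v $ i"
    have w: "w = c *\<^sub>R v" unfolding vec_eq_iff using \<open>v $ i \<noteq> 0\<close> all by (metis c_def nonzero_eq_divide_eq real_scaleR_def vector_scaleR_component)
    then have "M *v w = c *\<^sub>R (M *v v)" by (simp add: matrix_vector_mult_scaleR)
    then show "norm (M *v w) \<le> norm (M *v v) / norm v * norm w"
      using w False by simp
  qed
  then show ?thesis
    using False norm_matrix_vector_le_spectral[of M v] by (simp add: field_simps)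
qed simp

section \<open>Growth of solutions of a perturbed linear system\<close>

text \<open>The norm is not differentiable at a zero of \<open>r\<close>, but the right derivative exists there, and the
  factor \<open>c\<close> has to be merely continuous.\<close>
lemma has_real_derivative_mult_norm_at_zero:
  fixes r :: "real \<Rightarrow> 'a::real_normed_vector"
  assumes r: "(r has_vector_derivative g) (at t within {t..})" and "r t = 0"
    and c: "(c \<longlongrightarrow> c t) (at_right t)"
  shows "((\<lambda>s. c s * norm (r s)) has_real_derivative c t * norm g) (at t within {t..})"
proof -
  have "((\<lambda>s. (1 / norm (s - t)) *\<^sub>R (r s - (r t + (s - t) *\<^sub>R g))) \<longlongrightarrow> 0) (at_right t)"
    using r by (simp add: has_vector_derivative_def has_derivative_within at_within_Ici_at_right)
  moreover have "\<forall>\<^sub>F s in at_right t.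
      (1 / norm (s - t)) *\<^sub>R (r s - (r t + (s - t) *\<^sub>R g)) = (1 / (s - t)) *\<^sub>R r s - g"
    using eventually_at_right_less[of t]
    by eventually_elim (use \<open>r t = 0\<close> in \<open>simp add: scaleR_diff_right\<close>)
  ultimately have "((\<lambda>s. (1 / (s - t)) *\<^sub>R r s - g) \<longlongrightarrow> 0) (at_right t)"
    by (rule Lim_transform_eventually)
  then have "((\<lambda>s. (1 / (s - t)) *\<^sub>R r s) \<longlongrightarrow> g) (at_right t)" by (rule LIM_zero_cancel)
  from tendsto_mult[OF c tendsto_norm[OF this]]
  have "((\<lambda>s. c s * norm ((1 / (s - t)) *\<^sub>R r s)) \<longlongrightarrow> c t * norm g) (at_right t)" .
  moreover have "\<forall>\<^sub>F s in at_right t.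
      c s * norm ((1 / (s - t)) *\<^sub>R r s) = (c s * norm (r s) - c t * norm (r t)) / (s - t)"
    using eventually_at_right_less[of t]
    by eventually_elim (use \<open>r t = 0\<close> in simp)
  ultimately have "((\<lambda>s. (c s * norm (r s) - c t * norm (r t)) / (s - t)) \<longlongrightarrow> c t * norm g) (at_right t)"
    by (rule Lim_transform_eventually)
  then show ?thesis by (simp add: has_field_derivative_iff at_within_Ici_at_right)
qed

locale perturbed_linear_system =
  fixes t0 :: real and A W :: "real \<Rightarrow> real^'n^'n" and x g :: "real \<Rightarrow> real^'n"
    and p k :: "real \<Rightarrow> real"
  assumes x_deriv: "\<And>t. t \<ge> t0 \<Longrightarrow> (x has_vector_derivative A t *v x t + g t) (at t within {t0..})"
    and W_deriv: "\<And>t. t \<ge> t0 \<Longrightarrow> (W has_vector_derivative A t ** W t) (at t within {t0..})"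
    and W_invertible: "\<And>t. t \<ge> t0 \<Longrightarrow> invertible (W t)"
    and p_def: "\<And>t. t \<ge> t0 \<Longrightarrow>
      ((\<lambda>s. ln (spectral_norm (W s))) has_real_derivative p t) (at t within {t0..})"
    and k_def: "\<And>t. t \<ge> t0 \<Longrightarrow> k t = spectral_norm (W t) * spectral_norm (matrix_inv (W t))"
    and k_cont: "continuous_on {t0..} k"
begin

text \<open>The scalar majorant of \<open>norm (x t)\<close>: the largest norm that \<open>W t\<close> can give to a vector of the
  same length as the coordinate vector \<open>W\<^sup>-\<^sup>1 x\<close>.\<close>
definition amplitude :: "real \<Rightarrow> real" where
  "amplitude t = spectral_norm (W t) * norm (matrix_inv (W t) *v x t)"

text \<open>The difference to the unperturbed solution through \<open>x t\<close> at time \<open>t\<close>. It vanishes at time \<open>t\<close> and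
  its derivative there is the perturbation alone, so estimates of \<open>x\<close> near \<open>t\<close> need no derivative of
  \<open>matrix_inv (W s)\<close>.\<close>
definition deviation :: "real \<Rightarrow> real \<Rightarrow> real^'n" where
  "deviation t s = x s - W s *v (matrix_inv (W t) *v x t)"

lemma norm_le_amplitude: "t \<ge> t0 \<Longrightarrow> norm (x t) \<le> amplitude t"
  using norm_matrix_vector_le_spectral[of "W t" "matrix_inv (W t) *v x t"]
    matrix_inv_mult_vector(1)[OF W_invertible, of t "x t"]
  by (simp add: amplitude_def)

lemma spectral_norm_W_pos: "t \<ge> t0 \<Longrightarrow> 0 < spectral_norm (W t)"
  by (intro spectral_norm_pos W_invertible)

lemma x_continuous: "continuous_on {t0..} x"
  by (rule continuous_on_vector_derivative) (use x_deriv in auto)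

lemma spectral_norm_W_deriv:
  assumes "t \<ge> t0"
  shows "((\<lambda>s. spectral_norm (W s)) has_real_derivative p t * spectral_norm (W t)) (at t within {t0..})"
proof (rule has_field_derivative_transform_within[where d = 1])
  show "((\<lambda>s. exp (ln (spectral_norm (W s)))) has_real_derivative p t * spectral_norm (W t)) (at t within {t0..})"
    using DERIV_chain2[OF DERIV_exp p_def[OF assms]] spectral_norm_W_pos[OF assms]
    by (simp add: mult.commute)
qed (use assms spectral_norm_W_pos in auto)

lemma deviation_self: "t \<ge> t0 \<Longrightarrow> deviation t t = 0"
  by (simp add: deviation_def matrix_inv_mult_vector[OF W_invertible])

lemma deviation_deriv:
  assumes "t \<ge> t0"
  shows "(deviation t has_vector_derivative g t) (at t within {t0..})"
proof -
  let ?c = "matrix_inv (W t) *v x t"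
  have "((\<lambda>s. W s *v ?c) has_vector_derivative (A t ** W t) *v ?c) (at t within {t0..})"
    by (rule bounded_linear.has_vector_derivative[OF bounded_linear_matrix_apply W_deriv[OF assms]])
  moreover have "(A t ** W t) *v ?c = A t *v x t"
    by (simp only: matrix_vector_mul_assoc[symmetric] matrix_inv_mult_vector(1)[OF W_invertible[OF assms]])
  ultimately have "((\<lambda>s. x s - W s *v ?c) has_vector_derivative
      (A t *v x t + g t) - A t *v x t) (at t within {t0..})"
    by (intro has_vector_derivative_diff x_deriv[OF assms]) simp
  then show ?thesis by (simp add: deviation_def[abs_def])
qed

lemma matrix_inv_deviation:
  assumes "s \<ge> t0"
  shows "matrix_inv (W s) *v x s - matrix_inv (W t) *v x t = matrix_inv (W s) *v deviation t s"
  by (simp add: deviation_def matrix_vector_mult_diff_distrib matrix_inv_mult_vector[OF W_invertible[OF assms]])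

lemma amplitude_continuous: "continuous_on {t0..} amplitude"
  unfolding continuous_on_def
proof
  fix t assume "t \<in> {t0..}"
  then have t: "t \<ge> t0" by simp
  have W_tendsto: "((\<lambda>s. spectral_norm (W s)) \<longlongrightarrow> spectral_norm (W t)) (at t within {t0..})"
    using DERIV_continuous[OF spectral_norm_W_deriv[OF t]] by (simp add: continuous_within)
  have "(deviation t \<longlongrightarrow> 0) (at t within {t0..})"
    using has_vector_derivative_continuous[OF deviation_deriv[OF t]] deviation_self[OF t]
    by (simp add: continuous_within)
  moreover have "(k \<longlongrightarrow> k t) (at t within {t0..})"
    using k_cont t by (auto simp: continuous_on_def)
  ultimately have "((\<lambda>s. k s / spectral_norm (W s) * norm (deviation t s)) \<longlongrightarrow>
      k t / spectral_norm (W t) * norm (0 :: real^'n)) (at t within {t0..})"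
    using spectral_norm_W_pos[OF t] by (intro tendsto_intros W_tendsto) auto
  then have bound_lim: "((\<lambda>s. k s / spectral_norm (W s) * norm (deviation t s)) \<longlongrightarrow> 0) (at t within {t0..})"
    by simp
  have "\<forall>\<^sub>F s in at t within {t0..}.
      norm (matrix_inv (W s) *v x s - matrix_inv (W t) *v x t) \<le> k s / spectral_norm (W s) * norm (deviation t s)"
    unfolding eventually_at_filter
  proof (intro always_eventually allI impI)
    fix s assume "s \<noteq> t" "s \<in> {t0..}"
    then have s: "s \<ge> t0" by simp
    have "k s / spectral_norm (W s) = spectral_norm (matrix_inv (W s))"
      using spectral_norm_W_pos[OF s] by (simp add: k_def[OF s])
    then show "norm (matrix_inv (W s) *v x s - matrix_inv (W t) *v x t)
        \<le> k s / spectral_norm (W s) * norm (deviation t s)"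
      unfolding matrix_inv_deviation[OF s] by (simp add: norm_matrix_vector_le_spectral)
  qed
  from Lim_null_comparison[OF this bound_lim]
  have "((\<lambda>s. matrix_inv (W s) *v x s) \<longlongrightarrow> matrix_inv (W t) *v x t) (at t within {t0..})"
    by (rule LIM_zero_cancel)
  with W_tendsto show "(amplitude \<longlongrightarrow> amplitude t) (at t within {t0..})"
    unfolding amplitude_def by (intro tendsto_intros)
qed

text \<open>With \<open>c = k\<close> this function majorizes the amplitude, with \<open>c = 1\<close> it majorizes the norm of \<open>x\<close>; both
  contacts are at time \<open>t\<close>.\<close>
lemma norm_deviation_deriv:
  assumes t: "t \<ge> t0" and "continuous_on {t0..} c"
  shows "((\<lambda>s. spectral_norm (W s) * norm (matrix_inv (W t) *v x t) + c s * norm (deviation t s))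
      has_real_derivative p t * amplitude t + c t * norm (g t)) (at t within {t..})"
proof -
  have sub: "{t..} \<subseteq> {t0..}" using t by auto
  have "(c \<longlongrightarrow> c t) (at t within {t0..})" using assms by (auto simp: continuous_on_def)
  then have "(c \<longlongrightarrow> c t) (at_right t)"
    using sub by (metis at_within_Ici_at_right tendsto_within_subset)
  then have "((\<lambda>s. c s * norm (deviation t s)) has_real_derivative c t * norm (g t)) (at t within {t..})"
    by (intro has_real_derivative_mult_norm_at_zero deviation_self[OF t]
        has_vector_derivative_within_subset[OF deviation_deriv[OF t] sub])
  moreover have "((\<lambda>s. spectral_norm (W s) * norm (matrix_inv (W t) *v x t)) has_real_derivative
      p t * spectral_norm (W t) * norm (matrix_inv (W t) *v x t)) (at t within {t..})"
    by (rule DERIV_cmult_right[OF DERIV_subset[OF spectral_norm_W_deriv[OF t] sub]])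
  ultimately show ?thesis
    using DERIV_add by (fastforce simp: amplitude_def mult.assoc)
qed

lemma amplitude_upper_right_deriv:
  assumes t: "t \<ge> t0"
  shows "upper_right_deriv_le amplitude t (p t * amplitude t + k t * norm (g t))"
proof (rule upper_right_deriv_le_majorant[OF norm_deviation_deriv[OF t k_cont]])
  show "\<forall>\<^sub>F s in at_right t. amplitude s \<le>
      spectral_norm (W s) * norm (matrix_inv (W t) *v x t) + k s * norm (deviation t s)"
    using eventually_at_right_less[of t]
  proof eventually_elim
    case (elim s)
    then have s: "s \<ge> t0" using t by simp
    have "norm (matrix_inv (W s) *v x s) \<le> norm (matrix_inv (W t) *v x t) +
        norm (matrix_inv (W s) *v deviation t s)"
      unfolding matrix_inv_deviation[OF s, of t, symmetric] by (rule norm_triangle_sub)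
    also have "\<dots> \<le> norm (matrix_inv (W t) *v x t) + spectral_norm (matrix_inv (W s)) * norm (deviation t s)"
      by (intro add_left_mono norm_matrix_vector_le_spectral)
    finally have "amplitude s \<le> spectral_norm (W s) *
        (norm (matrix_inv (W t) *v x t) + spectral_norm (matrix_inv (W s)) * norm (deviation t s))"
      unfolding amplitude_def by (intro mult_left_mono spectral_norm_nonneg)
    then show ?case by (simp add: k_def[OF s] distrib_left mult.assoc)
  qed
qed (use t in \<open>simp add: amplitude_def deviation_self\<close>)

text \<open>When \<open>x t\<close> is a vector that \<open>W t\<close> stretches the most, the norm itself grows at most at the rate of
  \<open>\<parallel>W\<parallel>\<close> plus the perturbation. The condition number, which multiplies the perturbation in the bound for
  the amplitude, is absent.\<close>
lemma norm_upper_right_deriv: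
  assumes t: "t \<ge> t0" and extremal: "norm (x t) = amplitude t"
  shows "upper_right_deriv_le (\<lambda>s. norm (x s)) t (p t * norm (x t) + norm (g t))"
proof -
  have deriv: "((\<lambda>s. spectral_norm (W s) * norm (matrix_inv (W t) *v x t) + 1 * norm (deviation t s))
      has_real_derivative p t * amplitude t + 1 * norm (g t)) (at t within {t..})"
    by (rule norm_deviation_deriv[OF t continuous_on_const])
  have "upper_right_deriv_le (\<lambda>s. norm (x s)) t (p t * amplitude t + 1 * norm (g t))"
  proof (rule upper_right_deriv_le_majorant[OF deriv])
    show "\<forall>\<^sub>F s in at_right t. norm (x s) \<le>
        spectral_norm (W s) * norm (matrix_inv (W t) *v x t) + 1 * norm (deviation t s)"
    proof (intro always_eventually allI)
      fix s
      have "norm (x s) \<le> norm (W s *v (matrix_inv (W t) *v x t)) + norm (deviation t s)"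
        unfolding deviation_def by (rule norm_triangle_sub)
      also have "\<dots> \<le> spectral_norm (W s) * norm (matrix_inv (W t) *v x t) + norm (deviation t s)"
        by (intro add_right_mono norm_matrix_vector_le_spectral)
      finally show "norm (x s) \<le>
          spectral_norm (W s) * norm (matrix_inv (W t) *v x t) + 1 * norm (deviation t s)" by simp
    qed
  qed (use t extremal in \<open>simp add: amplitude_def deviation_self\<close>)
  then show ?thesis by (simp add: extremal)
qed

end

section \<open>Scalar quantities relaxing to a moving equilibrium\<close>

lemma weighted_mean_le:
  assumes "m \<le> d" "v \<le> (d::real)" "0 \<le> w" "w \<le> 1"
  shows "m + (v - m) * w \<le> d"
proof -
  have "m + (v - m) * w = (1 - w) * m + w * v" by (simp add: algebra_simps)
  also have "\<dots> \<le> (1 - w) * d + w * d" using assms by (intro add_mono mult_left_mono) auto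
  finally show ?thesis by (simp add: algebra_simps)
qed

text \<open>The coupling term \<open>h\<close> sees only the smaller quantity \<open>u\<close>. A bound on \<open>u\<close> thus gives a linear
  inequality for \<open>\<psi>\<close>, and the resulting bound on \<open>\<psi>\<close> is again a bound on \<open>u\<close>.\<close>
locale majorized_decay =
  fixes t0 \<kappa> :: real and h u \<psi> :: "real \<Rightarrow> real"
  assumes kappa_neg: "\<kappa> < 0" and h_mono: "mono_on {0..} h"
    and u_cont: "continuous_on {t0..} u" and \<psi>_cont: "continuous_on {t0..} \<psi>"
    and u_nonneg: "\<And>t. t \<ge> t0 \<Longrightarrow> 0 \<le> u t" and u_le: "\<And>t. t \<ge> t0 \<Longrightarrow> u t \<le> \<psi> t"
    and \<psi>_deriv: "\<And>t. t \<ge> t0 \<Longrightarrow> upper_right_deriv_le \<psi> t (\<kappa> * \<psi> t + h (u t))"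
begin

text \<open>The rest point of \<open>\<psi>' = \<kappa> \<psi> + h \<rho>\<close>, which \<open>\<psi>\<close> relaxes to while \<open>u \<le> \<rho>\<close>.\<close>
definition equilibrium :: "real \<Rightarrow> real" where
  "equilibrium \<rho> = - h \<rho> / \<kappa>"

lemma equilibrium_le_iff: "equilibrium \<rho> \<le> \<rho> \<longleftrightarrow> \<kappa> * \<rho> + h \<rho> \<le> 0"
  unfolding equilibrium_def neg_divide_le_eq[OF kappa_neg] by (auto simp: mult.commute)

lemma equilibrium_less_iff: "equilibrium \<rho> < \<rho> \<longleftrightarrow> \<kappa> * \<rho> + h \<rho> < 0"
  unfolding equilibrium_def neg_divide_less_eq[OF kappa_neg] by (auto simp: mult.commute)

lemma relaxation:
  assumes "t0 \<le> a" "a \<le> t" and le: "\<And>s. \<lbrakk>a \<le> s; s \<le> t\<rbrakk> \<Longrightarrow> u s \<le> \<rho>"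
  shows "\<psi> t \<le> equilibrium \<rho> + (\<psi> a - equilibrium \<rho>) * exp (\<kappa> * (t - a))"
proof -
  have "\<psi> t \<le> - h \<rho> / \<kappa> + (\<psi> a + h \<rho> / \<kappa>) * exp (\<kappa> * (t - a))"
  proof (rule linear_Gronwall[where b = t, OF _ kappa_neg])
    show "continuous_on {a..t} \<psi>" using assms by (auto intro: continuous_on_subset[OF \<psi>_cont])
    fix s assume s: "a \<le> s" "s < t"
    have "h (u s) \<le> h \<rho>"
      using le[of s] u_nonneg[of s] s assms(1) by (intro mono_onD[OF h_mono]) auto
    then show "upper_right_deriv_le \<psi> s (\<kappa> * \<psi> s + h \<rho>)"
      using s assms(1) by (intro upper_right_deriv_le_mono[OF \<psi>_deriv]) auto
  qed (use assms in auto)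
  then show ?thesis by (simp add: equilibrium_def)
qed

text \<open>While \<open>u \<le> d\<close>, relaxation keeps \<open>\<psi> \<le> d\<close>, because the equilibrium for \<open>d\<close> does not exceed \<open>d\<close>.
  Since \<open>u \<le> \<psi>\<close>, the bound on \<open>u\<close> extends by continuity unless \<open>u = \<psi> = d\<close>; the escape hypothesis is what
  the differential inequality cannot supply at such a time when \<open>h\<close> jumps at \<open>d\<close>.\<close>
lemma amplitude_le_root:
  assumes "t0 \<le> a" "0 \<le> d" "\<kappa> * d + h d \<le> 0" "\<psi> a \<le> d"
    and escape: "\<And>t. \<lbrakk>a \<le> t; \<And>s. \<lbrakk>a \<le> s; s \<le> t\<rbrakk> \<Longrightarrow> u s \<le> d; u t = d; \<psi> t = d\<rbrakk>
                   \<Longrightarrow> \<forall>\<^sub>F s in at_right t. u s \<le> d"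
    and "a \<le> t"
  shows "\<psi> t \<le> d"
proof -
  have amp: "\<psi> \<tau> \<le> d" if \<tau>: "a \<le> \<tau>" and le: "\<And>s. \<lbrakk>a \<le> s; s \<le> \<tau>\<rbrakk> \<Longrightarrow> u s \<le> d" for \<tau>
  proof -
    have "\<psi> \<tau> \<le> equilibrium d + (\<psi> a - equilibrium d) * exp (\<kappa> * (\<tau> - a))"
      by (rule relaxation[OF \<open>t0 \<le> a\<close> \<tau> le])
    also have "\<dots> \<le> d"
      using assms \<tau> kappa_neg by (intro weighted_mean_le) (auto simp: equilibrium_le_iff mult_nonpos_nonneg)
    finally show ?thesis .
  qed
  have "u r - d \<le> 0" if r: "a \<le> r" for r
  proof (rule nonpos_by_continuation[where a = a and b = r and \<phi> = "\<lambda>s. u s - d"])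
    show cont: "continuous_on {a..r} (\<lambda>s. u s - d)"
      using \<open>t0 \<le> a\<close> by (intro continuous_intros continuous_on_subset[OF u_cont]) auto
    show "u a - d \<le> 0" using u_le[of a] assms by simp
    fix \<tau> assume \<tau>: "a \<le> \<tau>" "\<tau> < r" and "\<And>s. \<lbrakk>a \<le> s; s \<le> \<tau>\<rbrakk> \<Longrightarrow> u s - d \<le> 0"
    then have le: "u s \<le> d" if "a \<le> s" "s \<le> \<tau>" for s using that by force
    show "\<forall>\<^sub>F s in at_right \<tau>. u s - d \<le> 0"
    proof (cases "u \<tau> = d")
      case True
      then have "\<psi> \<tau> = d" using amp[OF \<tau>(1) le] u_le[of \<tau>] \<tau> \<open>t0 \<le> a\<close> by simp
      from escape[OF \<tau>(1) le True this] show ?thesis by simp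
    next
      case False
      then have "u \<tau> - d < 0" using le[of \<tau>] \<tau> by simp
      from continuous_on_eventually_at_right_less[OF cont \<tau> this]
      show ?thesis by eventually_elim simp
    qed
  qed (use r in auto)
  then show ?thesis using amp[OF \<open>a \<le> t\<close>] by simp
qed

text \<open>Relaxation from a value strictly below \<open>d\<close> never reaches \<open>d\<close>, so the critical case of
  \<open>amplitude_le_root\<close> does not occur.\<close>
lemma amplitude_less_root:
  assumes "t0 \<le> a" "0 \<le> d" "\<kappa> * d + h d \<le> 0" "\<psi> a < d" "a \<le> t"
  shows "\<psi> t < d"
proof -
  have strict: "\<psi> \<tau> < d" if \<tau>: "a \<le> \<tau>" and le: "\<And>s. \<lbrakk>a \<le> s; s \<le> \<tau>\<rbrakk> \<Longrightarrow> u s \<le> d" for \<tau>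
  proof -
    have "\<psi> \<tau> \<le> equilibrium d + (\<psi> a - equilibrium d) * exp (\<kappa> * (\<tau> - a))"
      by (rule relaxation[OF \<open>t0 \<le> a\<close> \<tau> le])
    also have "\<dots> < equilibrium d + (d - equilibrium d) * exp (\<kappa> * (\<tau> - a))"
      using \<open>\<psi> a < d\<close> by simp
    also have "\<dots> \<le> d"
      using assms \<tau> kappa_neg by (intro weighted_mean_le) (auto simp: equilibrium_le_iff mult_nonpos_nonneg)
    finally show ?thesis .
  qed
  have "\<psi> r \<le> d" if "a \<le> r" for r
  proof (rule amplitude_le_root[OF assms(1-3) less_imp_le[OF assms(4)] _ that])
    fix \<tau> assume "a \<le> \<tau>" "\<And>s. \<lbrakk>a \<le> s; s \<le> \<tau>\<rbrakk> \<Longrightarrow> u s \<le> d" "\<psi> \<tau> = d"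
    then show "\<forall>\<^sub>F s in at_right \<tau>. u s \<le> d" using strict[of \<tau>] by simp
  qed
  then have "u s \<le> d" if "a \<le> s" for s using that u_le[of s] \<open>t0 \<le> a\<close> by force
  then show ?thesis using strict[OF \<open>a \<le> t\<close>] by simp
qed

text \<open>If \<open>u\<close> is below \<open>d\<close> at one time, it is below some \<open>\<rho> < d\<close> for a while, and during that while \<open>\<psi>\<close>
  relaxes from at most \<open>d\<close> towards an equilibrium strictly below \<open>d\<close>.\<close>
lemma amplitude_enters_below:
  assumes d: "0 \<le> c" "c < d" and neg: "\<And>X. \<lbrakk>c < X; X < d\<rbrakk> \<Longrightarrow> \<kappa> * X + h X < 0"
    and le: "\<And>t. t \<ge> t0 \<Longrightarrow> \<psi> t \<le> d" and s: "t0 \<le> s" "u s < d"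
  shows "\<exists>a\<ge>t0. \<psi> a < d"
proof -
  define \<rho> where "\<rho> = (max (u s) c + d) / 2"
  have \<rho>: "u s < \<rho>" "c < \<rho>" "\<rho> < d" using s d by (auto simp: \<rho>_def max_def)
  have "continuous_on {s..s + 1} u" using s by (auto intro: continuous_on_subset[OF u_cont])
  then have "\<forall>\<^sub>F r in at_right s. u r < \<rho>"
    by (rule continuous_on_eventually_at_right_less) (use \<rho> in auto)
  then obtain b where b: "s < b" "\<And>r. \<lbrakk>s < r; r < b\<rbrakk> \<Longrightarrow> u r < \<rho>"
    unfolding eventually_at_right_field by blast
  define a where "a = (s + b) / 2"
  have a: "s < a" "a < b" using b by (auto simp: a_def)
  have "u r \<le> \<rho>" if "s \<le> r" "r \<le> a" for r
    using b(2)[of r] \<rho>(1) a that by (cases "r = s") auto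
  then have "\<psi> a \<le> equilibrium \<rho> + (\<psi> s - equilibrium \<rho>) * exp (\<kappa> * (a - s))"
    using a s by (intro relaxation) auto
  also have "\<dots> \<le> equilibrium \<rho> + (d - equilibrium \<rho>) * exp (\<kappa> * (a - s))"
    using le[OF s(1)] by (intro add_left_mono mult_right_mono) auto
  also have "\<dots> < equilibrium \<rho> + (d - equilibrium \<rho>) * 1"
  proof -
    have "equilibrium \<rho> < d" using neg[OF \<rho>(2,3)] \<rho>(3) by (simp flip: equilibrium_less_iff)
    moreover have "exp (\<kappa> * (a - s)) < 1" using kappa_neg a by (simp add: mult_neg_pos)
    ultimately show ?thesis by (intro add_strict_left_mono mult_strict_left_mono) auto
  qed
  finally show ?thesis using a s by (intro exI[of _ a]) auto
qed

lemma eventually_le_above_equilibrium: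
  assumes ev: "\<forall>\<^sub>F t in at_top. u t \<le> \<rho>" and "equilibrium \<rho> < \<mu>"
  shows "\<forall>\<^sub>F t in at_top. u t \<le> \<mu>"
proof -
  from ev obtain a0 where a0: "\<And>t. t \<ge> a0 \<Longrightarrow> u t \<le> \<rho>" by (auto simp: eventually_at_top_linorder)
  define a where "a = max a0 t0"
  have "filterlim (\<lambda>t. - a + t) at_top at_top"
    by (intro filterlim_tendsto_add_at_top[OF tendsto_const] filterlim_ident)
  then have "filterlim (\<lambda>t. \<kappa> * (- a + t)) at_bot at_top"
    by (intro filterlim_tendsto_neg_mult_at_bot[OF tendsto_const kappa_neg])
  then have "((\<lambda>t. exp (\<kappa> * (- a + t))) \<longlongrightarrow> 0) at_top"
    by (rule filterlim_compose[OF exp_at_bot])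
  then have "((\<lambda>t. equilibrium \<rho> + (\<psi> a - equilibrium \<rho>) * exp (\<kappa> * (- a + t))) \<longlongrightarrow>
      equilibrium \<rho> + (\<psi> a - equilibrium \<rho>) * 0) at_top"
    by (intro tendsto_intros)
  then have "\<forall>\<^sub>F t in at_top. equilibrium \<rho> + (\<psi> a - equilibrium \<rho>) * exp (\<kappa> * (- a + t)) < \<mu>"
    by (rule order_tendstoD) (use assms(2) in simp)
  then show ?thesis using eventually_ge_at_top[of a]
  proof eventually_elim
    case (elim t)
    have "\<psi> t \<le> equilibrium \<rho> + (\<psi> a - equilibrium \<rho>) * exp (\<kappa> * (t - a))"
      using a0 elim by (intro relaxation) (auto simp: a_def)
    then show ?case using elim u_le[of t] by (simp add: a_def)
  qed
qed

text \<open>If the infimum \<open>\<rho>\<close> of the eventual bounds on \<open>u\<close> were above \<open>c\<close>, an eventual bound close to \<open>\<rho>\<close>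
  would have its equilibrium below \<open>\<rho>\<close> by continuity of \<open>h\<close>, and would improve to a bound below \<open>\<rho>\<close>.\<close>
lemma eventually_le_lower_root:
  assumes "0 \<le> c" "c < d" and neg: "\<And>X. \<lbrakk>c < X; X < d\<rbrakk> \<Longrightarrow> \<kappa> * X + h X < 0"
    and h_cont: "continuous_on {c<..<d} h"
    and a: "t0 \<le> a" "\<psi> a < d" and "e > 0"
  shows "\<forall>\<^sub>F t in at_top. u t \<le> c + e"
proof -
  define S where "S = {\<rho>. c < \<rho> \<and> \<rho> < d \<and> (\<forall>\<^sub>F t in at_top. u t \<le> \<rho>)}"
  define \<rho>0 where "\<rho>0 = (max (\<psi> a) c + d) / 2"
  have \<rho>0: "\<psi> a < \<rho>0" "c < \<rho>0" "\<rho>0 < d" using a \<open>c < d\<close> by (auto simp: \<rho>0_def max_def)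
  have "u t \<le> \<rho>0" if "t \<ge> a" for t
  proof -
    have "\<psi> t < \<rho>0"
      by (rule amplitude_less_root[of a]) (use neg[OF \<rho>0(2,3)] \<rho>0 \<open>0 \<le> c\<close> a that in auto)
    then show ?thesis using u_le[of t] that a by simp
  qed
  then have "\<rho>0 \<in> S" using \<rho>0 by (auto simp: S_def eventually_at_top_linorder)
  have bdd: "bdd_below S" by (rule bdd_belowI[of _ c]) (simp add: S_def)
  define \<rho> where "\<rho> = Inf S"
  have "\<rho> \<le> \<rho>0" unfolding \<rho>_def by (rule cInf_lower[OF \<open>\<rho>0 \<in> S\<close> bdd])
  have "c \<le> \<rho>" unfolding \<rho>_def by (rule cInf_greatest) (use \<open>\<rho>0 \<in> S\<close> in \<open>auto simp: S_def\<close>)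
  have "\<rho> = c"
  proof (rule ccontr)
    assume "\<rho> \<noteq> c"
    then have range: "c < \<rho>" "\<rho> < d" using \<open>c \<le> \<rho>\<close> \<open>\<rho> \<le> \<rho>0\<close> \<rho>0 by auto
    have "equilibrium \<rho> < \<rho>" using neg[OF range] by (simp add: equilibrium_less_iff)
    define \<mu> where "\<mu> = (max (equilibrium \<rho>) c + \<rho>) / 2"
    have \<mu>: "equilibrium \<rho> < \<mu>" "c < \<mu>" "\<mu> < \<rho>"
      using \<open>equilibrium \<rho> < \<rho>\<close> range by (auto simp: \<mu>_def max_def)
    have "isCont h \<rho>" using h_cont range by (auto simp: continuous_on_eq_continuous_at)
    then have "isCont equilibrium \<rho>"
      unfolding equilibrium_def[abs_def] using kappa_neg by (intro continuous_intros) auto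
    then have "(equilibrium \<longlongrightarrow> equilibrium \<rho>) (at_right \<rho>)"
      by (metis continuous_within_subset continuous_within subset_UNIV)
    then have "\<forall>\<^sub>F X in at_right \<rho>. equilibrium X < \<mu>" using \<mu>(1) by (rule order_tendstoD)
    then obtain b where b: "\<rho> < b" "\<And>X. \<lbrakk>\<rho> < X; X < b\<rbrakk> \<Longrightarrow> equilibrium X < \<mu>"
      unfolding eventually_at_right_field by blast
    obtain X where X: "X \<in> S" "X < b" "\<rho> \<le> X"
      using cInf_lessD[of S b] \<open>\<rho>0 \<in> S\<close> b(1) cInf_lower[OF _ bdd] unfolding \<rho>_def by blast
    have "equilibrium X < \<mu>" using b(2)[of X] X \<mu>(1) by (cases "X = \<rho>") auto
    with X(1) have "\<forall>\<^sub>F t in at_top. u t \<le> \<mu>"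
      by (auto simp: S_def intro: eventually_le_above_equilibrium[of X])
    then have "\<mu> \<in> S" using \<mu> range by (simp add: S_def)
    then have "\<rho> \<le> \<mu>" unfolding \<rho>_def by (rule cInf_lower[OF _ bdd])
    with \<mu> show False by simp
  qed
  then obtain X where X: "X \<in> S" "X < c + e"
    using cInf_lessD[of S "c + e"] \<open>\<rho>0 \<in> S\<close> \<open>e > 0\<close> unfolding \<rho>_def by force
  then have "\<forall>\<^sub>F t in at_top. u t \<le> X" by (simp add: S_def)
  then show ?thesis by eventually_elim (use X in simp)
qed

end

section \<open>The sign of an autonomous right-hand side above a stable zero\<close>

lemma pos_if_no_zero:
  fixes q :: "real \<Rightarrow> real"
  assumes "continuous_on S q" "connected S" "\<And>X. X \<in> S \<Longrightarrow> q X \<noteq> 0" "X \<in> S" "Y \<in> S" "0 < q X"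
  shows "0 < q Y"
proof (rule ccontr)
  assume "\<not> 0 < q Y"
  have "connected (q ` S)" using assms(1,2) by (rule connected_continuous_image)
  then have "0 \<in> q ` S"
    using assms(4-6) \<open>\<not> 0 < q Y\<close> unfolding connected_iff_interval by (meson imageI less_imp_le not_less)
  with assms(3) show False by auto
qed

text \<open>Without zeros between \<open>d2\<close> and \<open>d1\<close>, the sign of \<open>q\<close> is constant there. If it were positive, a solution
  starting slightly above \<open>d2\<close> could not return, would grow at a rate bounded below while it
  stays near \<open>d2\<close>, and so would leave the neighbourhood, contrary to stability.\<close>
lemma negative_above_stable_root:
  fixes q :: "real \<Rightarrow> real"
  assumes d: "0 < d2" "d2 < d1" and q_cont: "continuous_on {0..d1} q" and "0 < q 0"
    and roots: "{X. X > 0 \<and> q X = 0} = {d1, d2}"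
    and solvable: "\<And>X0. X0 \<in> {0..d1} \<Longrightarrow> \<exists>u. solves_on (\<lambda>_. q) {0..} {t0..} u \<and> u t0 = X0"
    and stable: "stable_fixed_solution q {0..} t0 d2"
    and X: "d2 < X" "X < d1"
  shows "q X < 0"
proof (rule ccontr)
  have root_iff: "q Y = 0 \<longleftrightarrow> Y = d1 \<or> Y = d2" if "Y > 0" for Y
    using roots that by blast
  assume "\<not> q X < 0"
  then have "q X > 0" using root_iff[of X] X d by force
  have pos: "q Y > 0" if "d2 < Y" "Y < d1" for Y
  proof (rule pos_if_no_zero[where q = q and Y = Y and S = "{d2<..<d1}" and X = X])
    show "continuous_on {d2<..<d1} q" using q_cont by (rule continuous_on_subset) (use d in auto)
  qed (use X that d root_iff \<open>q X > 0\<close> in auto)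
  have "q Y > 0" if "0 \<le> Y" "Y < d2" for Y
  proof (rule pos_if_no_zero[where q = q and Y = Y and S = "{0..<d2}" and X = 0])
    show "continuous_on {0..<d2} q" using q_cont by (rule continuous_on_subset) (use d in auto)
    fix Z assume "Z \<in> {0..<d2}"
    then show "q Z \<noteq> 0" using root_iff[of Z] d \<open>0 < q 0\<close> by (cases "Z = 0") auto
  qed (use that d \<open>0 < q 0\<close> in auto)
  with pos have nonneg: "q Y \<ge> 0" if "0 \<le> Y" "Y < d1" for Y
    using that root_iff[of d2] d by (cases Y d2 rule: linorder_cases) (auto intro: less_imp_le)
  define e where "e = (d1 - d2) / 2"
  have "e > 0" using d by (simp add: e_def)
  then obtain \<delta> where "\<delta> > 0" and \<delta>: "\<forall>T\<ge>t0. \<forall>u.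
      solves_on (\<lambda>_. q) {0..} {t0..T} u \<and> norm (u t0 - d2) < \<delta> \<longrightarrow> norm (u T - d2) < e"
    using stable unfolding stable_fixed_solution_def by meson
  \<comment> \<open>above \<open>d2\<close>, within the distance \<open>\<delta>\<close> that stability allows, and below \<open>d2 + e < d1\<close>\<close>
  define X0 where "X0 = d2 + min \<delta> e / 2"
  have X0: "d2 < X0" "X0 < d2 + e" "X0 - d2 < \<delta>" using \<open>\<delta> > 0\<close> \<open>e > 0\<close> by (auto simp: X0_def)
  have e: "d2 + e < d1" using d by (simp add: e_def field_simps)
  obtain u where u: "solves_on (\<lambda>_. q) {0..} {t0..} u" and u0: "u t0 = X0"
    using solvable[of X0] X0 e d by auto
  have u_deriv: "(u has_real_derivative q (u t)) (at t within {t0..})" if "t \<ge> t0" for t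
    using u that by (simp add: solves_on_def has_real_derivative_iff_has_vector_derivative)
  have u_cont: "continuous_on {t0..} u" by (rule DERIV_continuous_on[OF u_deriv]) simp
  have near: "\<bar>u T - d2\<bar> < e" if "T \<ge> t0" for T
  proof -
    have "solves_on (\<lambda>_. q) {0..} {t0..T} u"
      using u has_vector_derivative_within_subset[of u _ _ "{t0..}" "{t0..T}"]
      unfolding solves_on_def by auto
    then show ?thesis using \<delta>[rule_format, of T u] that u0 X0 by simp
  qed
  have grow: "X0 + c * (T - t0) \<le> u T"
    if T: "T \<ge> t0" and c: "\<And>t. \<lbrakk>t0 \<le> t; t \<le> T\<rbrakk> \<Longrightarrow> c \<le> q (u t)" for c T
  proof -
    have "X0 + c * (T - t0) - u T \<le> 0"
    proof (rule nonpos_if_upper_right_deriv_nonpos[where a = t0 and b = T and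
          \<phi> = "\<lambda>t. X0 + c * (t - t0) - u t"])
      show "continuous_on {t0..T} (\<lambda>t. X0 + c * (t - t0) - u t)"
        by (intro continuous_intros continuous_on_subset[OF u_cont]) auto
      fix s assume s: "t0 \<le> s" "s < T"
      have "(u has_real_derivative q (u s)) (at s within {s..})"
        using u_deriv[OF s(1)] by (rule DERIV_subset) (use s in auto)
      then have "((\<lambda>t. X0 + c * (t - t0) - u t) has_real_derivative c - q (u s)) (at s within {s..})"
        by (auto intro!: derivative_eq_intros)
      then show "upper_right_deriv_le (\<lambda>t. X0 + c * (t - t0) - u t) s 0"
        by (rule has_real_derivative_imp_upper_right_deriv_le) (use c[of s] s in auto)
    qed (use T u0 in auto)
    then show ?thesis by simp
  qed
  have u_ge: "X0 \<le> u T" if "T \<ge> t0" for T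
  proof -
    have "0 \<le> q (u t)" if "t \<ge> t0" for t
    proof (rule nonneg)
      show "0 \<le> u t" using u that by (simp add: solves_on_def)
      show "u t < d1" using near[OF that] e by linarith
    qed
    then show ?thesis using grow[OF that, of 0] by simp
  qed
  have "continuous_on {X0..d2 + e} q" using q_cont by (rule continuous_on_subset) (use X0 d e in auto)
  then obtain Y where Y: "Y \<in> {X0..d2 + e}" "\<And>Z. Z \<in> {X0..d2 + e} \<Longrightarrow> q Y \<le> q Z"
    using continuous_attains_inf[of "{X0..d2 + e}" q] X0 by auto
  have "q Y > 0" using pos[of Y] Y(1) X0 e by auto
  \<comment> \<open>by this time, growth at the minimal rate \<open>q Y\<close> has covered the distance \<open>e\<close>\<close>
  define T where "T = t0 + e / q Y"
  have "T \<ge> t0" using \<open>q Y > 0\<close> \<open>e > 0\<close> by (simp add: T_def)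
  have "q Y \<le> q (u t)" if "t \<ge> t0" for t
    using near[OF that] u_ge[OF that] by (intro Y(2)) auto
  then have "X0 + q Y * (T - t0) \<le> u T" using grow[OF \<open>T \<ge> t0\<close>] by simp
  moreover have "q Y * (T - t0) = e" using \<open>q Y > 0\<close> by (simp add: T_def)
  ultimately show False using near[OF \<open>T \<ge> t0\<close>] X0 by linarith
qed

section \<open>Trajectories with a majorized perturbation\<close>

text \<open>A single trajectory, with \<open>g\<close> the whole perturbation along it and \<open>\<phi>\<close> standing for the norm of the
  forcing term.\<close>
locale majorized_trajectory = perturbed_linear_system t0 A W x g p k
  for t0 :: real and A W :: "real \<Rightarrow> real^'n^'n" and x g :: "real \<Rightarrow> real^'n" and p k :: "real \<Rightarrow> real" +
  fixes L :: "real \<Rightarrow> real \<Rightarrow> real" and \<phi> :: "real \<Rightarrow> real"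
    and phat khat Fhat :: real and Lhat :: "real \<Rightarrow> real"
  assumes p_le: "\<And>t. t \<ge> t0 \<Longrightarrow> p t \<le> phat" and phat_neg: "phat < 0"
    and k_le: "\<And>t. t \<ge> t0 \<Longrightarrow> k t \<le> khat"
    and L_le: "\<And>t X. t \<ge> t0 \<Longrightarrow> X \<ge> 0 \<Longrightarrow> L t X \<le> Lhat X"
    and \<phi>_le: "\<And>t. t \<ge> t0 \<Longrightarrow> \<phi> t \<le> Fhat" and Fhat_pos: "0 < Fhat"
    and Lhat_mono: "mono_on {0..} Lhat" and Lhat_zero: "Lhat 0 = 0"
    and g_le: "\<And>t. t \<ge> t0 \<Longrightarrow> norm (g t) \<le> L t (norm (x t)) + \<phi> t"
begin

lemma k_ge_1: "t \<ge> t0 \<Longrightarrow> 1 \<le> k t"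
  using condition_number_ge_1[OF W_invertible] by (simp add: k_def)

lemma khat_ge_1: "1 \<le> khat"
  using k_ge_1[of t0] k_le[of t0] by simp

lemma Lhat_nonneg: "0 \<le> X \<Longrightarrow> 0 \<le> Lhat X"
  using mono_onD[OF Lhat_mono, of 0 X] Lhat_zero by simp

lemma g_le_hat: "t \<ge> t0 \<Longrightarrow> norm (g t) \<le> Lhat (norm (x t)) + Fhat"
  using g_le[of t] L_le[of t "norm (x t)"] \<phi>_le[of t] by simp

lemma norm_x_continuous: "continuous_on {t0..} (\<lambda>t. norm (x t))"
  by (intro continuous_intros x_continuous)

sublocale decay: majorized_decay t0 phat "\<lambda>X. khat * Lhat X + khat * Fhat" "\<lambda>t. norm (x t)" amplitude
proof
  show "mono_on {0..} (\<lambda>X. khat * Lhat X + khat * Fhat)"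
    using khat_ge_1 by (intro mono_onI add_right_mono mult_left_mono mono_onD[OF Lhat_mono]) auto
  fix t assume t: "t \<ge> t0"
  show "upper_right_deriv_le amplitude t (phat * amplitude t + (khat * Lhat (norm (x t)) + khat * Fhat))"
  proof (rule upper_right_deriv_le_mono[OF amplitude_upper_right_deriv[OF t]])
    have "0 \<le> amplitude t" using norm_le_amplitude[OF t] norm_ge_zero order_trans by blast
    then have "p t * amplitude t \<le> phat * amplitude t" by (intro mult_right_mono p_le[OF t])
    moreover have "k t * norm (g t) \<le> khat * (Lhat (norm (x t)) + Fhat)"
      using k_ge_1[OF t] khat_ge_1 by (intro mult_mono k_le[OF t] g_le_hat[OF t]) auto
    ultimately show "p t * amplitude t + k t * norm (g t)
        \<le> phat * amplitude t + (khat * Lhat (norm (x t)) + khat * Fhat)"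
      by (simp add: distrib_left)
  qed
qed (use phat_neg norm_x_continuous amplitude_continuous norm_le_amplitude in auto)

text \<open>The norm grows at most at the rate \<open>phat d + (Lhat d + Fhat)\<close>. Multiplying the positive bracket by
  \<open>khat > 1\<close> strictly increases this, and the result is nonpositive.\<close>
lemma extremal_point_descends:
  assumes t: "t \<ge> t0" and "1 < khat" and d: "0 \<le> d" "phat * d + (khat * Lhat d + khat * Fhat) \<le> 0"
    and eq: "norm (x t) = d" "amplitude t = d"
  shows "\<forall>\<^sub>F s in at_right t. norm (x s) < d"
proof -
  have "p t * d + norm (g t) \<le> phat * d + (Lhat d + Fhat)"
    using g_le_hat[OF t] eq d p_le[OF t] by (intro add_mono mult_right_mono) auto
  also have "\<dots> < phat * d + khat * (Lhat d + Fhat)"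
    using \<open>1 < khat\<close> Lhat_nonneg[OF d(1)] Fhat_pos by simp
  also have "\<dots> \<le> 0" using d by (simp add: distrib_left)
  finally have neg: "p t * d + norm (g t) < 0" .
  have "upper_right_deriv_le (\<lambda>s. norm (x s)) t (p t * d + norm (g t))"
    using norm_upper_right_deriv[OF t] eq by simp
  from upper_right_deriv_le_neg_imp_less[OF this neg] show ?thesis by (simp add: eq)
qed

lemma amplitude_le_root_multidim:
  assumes "1 < khat" "0 \<le> d" "phat * d + (khat * Lhat d + khat * Fhat) \<le> 0"
    and "amplitude t0 \<le> d" "t \<ge> t0"
  shows "amplitude t \<le> d"
proof (rule decay.amplitude_le_root[of t0])
  fix t assume "t0 \<le> t" "norm (x t) = d" "amplitude t = d"
  then have "\<forall>\<^sub>F s in at_right t. norm (x s) < d"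
    using extremal_point_descends assms by simp
  then show "\<forall>\<^sub>F s in at_right t. norm (x s) \<le> d" by eventually_elim simp
qed (use assms in auto)

text \<open>If \<open>x\<close> does not start below \<open>d\<close> in norm, it starts at an extremal point, descends at once, and the
  amplitude follows.\<close>
lemma exists_amplitude_less_root:
  assumes "1 < khat" "0 \<le> c" "c < d" and root: "phat * d + (khat * Lhat d + khat * Fhat) \<le> 0"
    and neg: "\<And>X. \<lbrakk>c < X; X < d\<rbrakk> \<Longrightarrow> phat * X + (khat * Lhat X + khat * Fhat) < 0"
    and init: "amplitude t0 \<le> d"
  shows "\<exists>a\<ge>t0. amplitude a < d"
proof -
  have le: "amplitude t \<le> d" if "t \<ge> t0" for t
    using amplitude_le_root_multidim[OF \<open>1 < khat\<close> _ root init that] assms by simp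
  have "\<exists>s\<ge>t0. norm (x s) < d"
  proof (cases "norm (x t0) < d")
    case False
    then have "norm (x t0) = d" "amplitude t0 = d"
      using norm_le_amplitude[of t0] init by auto
    then have "\<forall>\<^sub>F s in at_right t0. norm (x s) < d"
      using extremal_point_descends[of t0 d] assms by simp
    then obtain b where "t0 < b" "\<And>s. \<lbrakk>t0 < s; s < b\<rbrakk> \<Longrightarrow> norm (x s) < d"
      unfolding eventually_at_right_field by blast
    then show ?thesis by (intro exI[of _ "(t0 + b) / 2"]) auto
  qed auto
  then obtain s where "t0 \<le> s" "norm (x s) < d" by blast
  from decay.amplitude_enters_below[OF assms(2,3) neg le this] show ?thesis .
qed

text \<open>In dimension one every vector is stretched by exactly \<open>\<parallel>W\<parallel>\<close>, so \<open>u = \<psi>\<close> is a subsolution of the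
  auxiliary equation, which contains the time-dependent \<open>L\<close>. The majorized inequality with \<open>Lhat\<close>
  alone would not confine \<open>u\<close> if \<open>Lhat\<close> jumped at \<open>d\<close>.\<close>
lemma norm_le_root_one_dim:
  assumes "CARD('n) = 1"
    and G_def: "\<And>t X. G t X = p t * X + k t * L t X + k t * \<phi> t"
    and G_cont: "continuous_on ({t0..} \<times> {0..}) (\<lambda>(t, X). G t X)"
    and G_unique: "\<And>X. X \<ge> 0 \<Longrightarrow> unique_ivp G {0..} t0 X"
    and L_zero: "\<And>t. t \<ge> t0 \<Longrightarrow> 0 \<le> L t 0" and \<phi>_nonneg: "\<And>t. t \<ge> t0 \<Longrightarrow> 0 \<le> \<phi> t"
    and d: "0 \<le> d" "phat * d + (khat * Lhat d + khat * Fhat) \<le> 0"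
    and init: "amplitude t0 \<le> d" and t: "t \<ge> t0"
  shows "norm (x t) \<le> d"
proof -
  have amp: "amplitude s = norm (x s)" if "s \<ge> t0" for s
    using norm_matrix_vector_one_dim[OF assms(1), of "W s" "matrix_inv (W s) *v x s"]
    by (simp add: amplitude_def matrix_inv_mult_vector[OF W_invertible[OF that]])
  have amp_nonneg: "0 \<le> amplitude s" if "s \<ge> t0" for s by (simp add: amp[OF that])
  obtain y where y: "solves_on G {0..} {t0..} y" and y0: "y t0 = amplitude t0"
    using G_unique[OF amp_nonneg[of t0]] unfolding unique_ivp_def by auto
  have y_on: "solves_on G {0..} {t0..t} y"
    using y has_vector_derivative_within_subset[of y _ _ "{t0..}" "{t0..t}"]
    unfolding solves_on_def by auto
  have cont: "continuous_on ({t0..t} \<times> {0..}) (\<lambda>(t, X). G t X)"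
    using G_cont by (rule continuous_on_subset) auto
  have uniq: "unique_ivp G {0..} t0 (y t0)" using G_unique amp_nonneg[of t0] y0 by simp
  have "amplitude t \<le> y t"
  proof (rule subsolution_le_unique_ivp[OF t cont uniq y_on])
    show "continuous_on {t0..t} amplitude" by (rule continuous_on_subset[OF amplitude_continuous]) auto
    fix s assume s: "t0 \<le> s" "s < t"
    have "k s * norm (g s) \<le> k s * (L s (amplitude s) + \<phi> s)"
      using g_le[OF s(1)] k_ge_1[OF s(1)] by (intro mult_left_mono) (auto simp: amp[OF s(1)])
    then show "upper_right_deriv_le amplitude s (G s (amplitude s))"
      by (intro upper_right_deriv_le_mono[OF amplitude_upper_right_deriv[OF s(1)]])
        (simp add: G_def distrib_left)
  qed (use amp_nonneg y0 in auto)
  also have "y t \<le> d"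
  proof (rule unique_ivp_le_constant_supersolution[OF t cont uniq y_on])
    fix s assume "s \<in> {t0..t}"
    then have s: "s \<ge> t0" by simp
    show "0 \<le> G s 0" using L_zero[OF s] \<phi>_nonneg[OF s] k_ge_1[OF s] by (simp add: G_def)
    have "p s * d \<le> phat * d" by (intro mult_right_mono p_le[OF s] d)
    moreover have "k s * L s d \<le> khat * Lhat d"
    proof -
      have "k s * L s d \<le> k s * Lhat d"
        using k_ge_1[OF s] by (intro mult_left_mono L_le[OF s d(1)]) auto
      also have "\<dots> \<le> khat * Lhat d" by (intro mult_right_mono k_le[OF s] Lhat_nonneg d)
      finally show ?thesis .
    qed
    moreover have "k s * \<phi> s \<le> khat * Fhat"
      using k_ge_1[OF s] khat_ge_1 by (intro mult_mono k_le[OF s] \<phi>_le[OF s] \<phi>_nonneg[OF s]) auto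
    ultimately show "G s d \<le> 0" using d by (simp add: G_def)
  qed (use init y0 amp_nonneg in auto)
  finally show ?thesis using norm_le_amplitude[OF t] by simp
qed

end

section \<open>Boundedness and asymptotic bound\<close>

theorem theorem4:
  fixes t0 :: real
    and A A' :: "real \<Rightarrow> real^'n^'n"
    and f :: "real \<Rightarrow> real^'n \<Rightarrow> real^'n"
    and F :: "real \<Rightarrow> real^'n"
    and x :: "real \<Rightarrow> real^'n \<Rightarrow> real^'n"
    and W :: "real \<Rightarrow> real^'n^'n"
    and \<Omega> :: "(real^'n) set"
    and L :: "real \<Rightarrow> real \<Rightarrow> real"
    and p k :: "real \<Rightarrow> real"
    and sbar slow phat khat Fhat :: real
    and Lhat :: "real \<Rightarrow> real"
    and Q :: "real \<Rightarrow> real \<Rightarrow> real"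
  \<comment> \<open>the equation\<close>
  assumes A_bounded: "bounded (A ` {t0..})"
    and A_deriv: "\<And>t. t \<ge> t0 \<Longrightarrow> (A has_vector_derivative A' t) (at t within {t0..})"
    and A'_cont: "continuous_on {t0..} A'"
    and f_cont: "continuous_on ({t0..} \<times> UNIV) (\<lambda>(t, y). f t y)"
    and f_bounded: "bounded ((\<lambda>(t, y). f t y) ` ({t0..} \<times> UNIV))"
    and f_zero: "\<And>t. t \<ge> t0 \<Longrightarrow> f t 0 = 0"
    and F_cont: "continuous_on {t0..} F"
    and F_bounded: "bounded (F ` {t0..})"
    and x_unique: "\<And>x0. unique_ivp (\<lambda>t y. A t *v y + f t y + F t) UNIV t0 x0"
    and x_solution:
      "\<And>x0. solves_on (\<lambda>t y. A t *v y + f t y + F t) UNIV {t0..} (\<lambda>t. x t x0) \<and> x t0 x0 = x0"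
  \<comment> \<open>the fundamental matrix, and the functions p and k\<close>
    and W_deriv: "\<And>t. t \<ge> t0 \<Longrightarrow> (W has_vector_derivative A t ** W t) (at t within {t0..})"
    and W_invertible: "\<And>t. t \<ge> t0 \<Longrightarrow> invertible (W t)"
    and W_initial: "spectral_norm (W t0) = 1"
    and W_simple: "\<And>t. t \<ge> t0 \<Longrightarrow> simple_sigma_max (W t)"
    and W_upper: "\<And>t. t \<ge> t0 \<Longrightarrow> sigma_max (W t) \<le> sbar"
    and W_lower: "\<And>t. t \<ge> t0 \<Longrightarrow> slow \<le> sigma_min (W t)"
    and p_def: "\<And>t. t \<ge> t0 \<Longrightarrow>
      ((\<lambda>s. ln (spectral_norm (W s))) has_real_derivative p t) (at t within {t0..})"
    and p_cont: "continuous_on {t0..} p"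
    and k_def: "\<And>t. t \<ge> t0 \<Longrightarrow> k t = spectral_norm (W t) * spectral_norm (matrix_inv (W t))"
    and k_cont: "continuous_on {t0..} k"
    and k_bounded: "bounded (k ` {t0..})"
  \<comment> \<open>the nonlinear Lipschitz inequality and the auxiliary equation\<close>
    and Omega_nbhd: "0 \<in> interior \<Omega>"
    and L_cont: "continuous_on ({t0..} \<times> {0..}) (\<lambda>(t, X). L t X)"
    and f_le_L: "\<And>t y. t \<ge> t0 \<Longrightarrow> y \<in> \<Omega> \<Longrightarrow> norm (f t y) \<le> L t (norm y)"
    and aux_unique: "\<And>X0. X0 \<ge> 0 \<Longrightarrow>
      unique_ivp (\<lambda>t X. p t * X + k t * L t X + k t * norm (F t)) {0..} t0 X0"
  \<comment> \<open>the suprema and the autonomous right-hand side Q\<close>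
    and p_bdd: "bdd_above (p ` {t0..})"
    and phat_def: "phat = (SUP t\<in>{t0..}. p t)"
    and khat_def: "khat = (SUP t\<in>{t0..}. k t)"
    and L_bdd: "\<And>X. X \<ge> 0 \<Longrightarrow> bdd_above ((\<lambda>t. L t X) ` {t0..})"
    and Lhat_def: "\<And>X. X \<ge> 0 \<Longrightarrow> Lhat X = (SUP t\<in>{t0..}. L t X)"
    and Fhat_def: "Fhat = (SUP t\<in>{t0..}. norm (F t))"
    and Lhat_zero: "Lhat 0 = 0"
    and Q_def: "\<And>X Y. Q X Y = phat * X + khat * Lhat X + khat * Y"
  \<comment> \<open>the specific hypotheses\<close>
    and Fhat_nonzero: "Fhat \<noteq> 0"
    and phat_neg: "phat < 0"
    and Lhat_mono: "mono_on {0..} Lhat"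
  shows
    "(\<forall>d1 d2. d1 > d2 \<and> d2 > 0 \<and> {X. X > 0 \<and> Q X Fhat = 0} = {d1, d2} \<and>
        (\<forall>X0\<in>{0..d1}. unique_ivp (\<lambda>t X. Q X Fhat) {0..} t0 X0) \<and>
        \<not> stable_fixed_solution (\<lambda>X. Q X Fhat) {0..} t0 d1 \<and>
        stable_fixed_solution (\<lambda>X. Q X Fhat) {0..} t0 d2
      \<longrightarrow>
        (\<forall>x0\<in>omega_set W t0 d1. (\<forall>t\<ge>t0. x t x0 \<in> \<Omega>) \<longrightarrow> (\<forall>t\<ge>t0. norm (x t x0) \<le> d1)) \<and>
        (\<forall>x0\<in>omega_set W t0 d2. (\<forall>t\<ge>t0. x t x0 \<in> \<Omega>) \<longrightarrow> (\<forall>t\<ge>t0. norm (x t x0) \<le> d2)) \<and>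
        (continuous_on {0..d1} Lhat \<longrightarrow>
          (\<forall>x0\<in>omega_set W t0 d1. (\<forall>t\<ge>t0. x t x0 \<in> \<Omega>) \<and>
              (CARD('n) = 1 \<longrightarrow> norm (matrix_inv (W t0) *v x0) \<noteq> d1) \<longrightarrow>
            Limsup at_top (\<lambda>t. ereal (norm (x t x0))) \<le> ereal d2)))
     \<and>
     (\<forall>d>0. {X. X > 0 \<and> Q X Fhat = 0} = {d} \<and>
        (\<forall>X0\<in>{0..d}. unique_ivp (\<lambda>t X. Q X Fhat) {0..} t0 X0)
      \<longrightarrow>
        (\<forall>x0\<in>omega_set W t0 d. (\<forall>t\<ge>t0. x t x0 \<in> \<Omega>) \<longrightarrow> (\<forall>t\<ge>t0. norm (x t x0) \<le> d)))"
proof -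
  have p_le: "p t \<le> phat" if "t \<ge> t0" for t
    unfolding phat_def using that by (intro cSUP_upper p_bdd) auto
  have k_bdd: "bdd_above (k ` {t0..})" by (rule bounded_imp_bdd_above[OF k_bounded])
  have k_le: "k t \<le> khat" if "t \<ge> t0" for t
    unfolding khat_def using that by (intro cSUP_upper k_bdd) auto
  have L_le: "L t X \<le> Lhat X" if "t \<ge> t0" "X \<ge> 0" for t X
    unfolding Lhat_def[OF that(2)] using that by (intro cSUP_upper L_bdd) auto
  have "bdd_above ((\<lambda>t. norm (F t)) ` {t0..})"
    using F_bounded unfolding bounded_iff bdd_above_def by auto
  then have F_le: "norm (F t) \<le> Fhat" if "t \<ge> t0" for t
    unfolding Fhat_def using that by (intro cSUP_upper) auto
  have Fhat_pos: "0 < Fhat" using F_le[of t0] norm_ge_zero[of "F t0"] Fhat_nonzero by linarith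
  have Q_eq: "Q X Fhat = phat * X + (khat * Lhat X + khat * Fhat)" for X by (simp add: Q_def)

  have trajectory: "majorized_trajectory t0 A W (\<lambda>t. x t x0) (\<lambda>t. f t (x t x0) + F t) p k
      L (\<lambda>t. norm (F t)) phat khat Fhat Lhat" if stays: "\<forall>t\<ge>t0. x t x0 \<in> \<Omega>" for x0
  proof
    fix t assume t: "t \<ge> t0"
    have "t \<in> {t0..}" using t by simp
    then show "((\<lambda>t. x t x0) has_vector_derivative A t *v x t x0 + (f t (x t x0) + F t)) (at t within {t0..})"
      using x_solution[of x0] unfolding solves_on_def by (simp add: add.assoc)
    have "norm (f t (x t x0) + F t) \<le> norm (f t (x t x0)) + norm (F t)" by (rule norm_triangle_ineq)
    also have "\<dots> \<le> L t (norm (x t x0)) + norm (F t)" using f_le_L[OF t] stays t by simp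
    finally show "norm (f t (x t x0) + F t) \<le> L t (norm (x t x0)) + norm (F t)" .
  qed (fact W_deriv W_invertible p_def k_def k_cont p_le phat_neg k_le L_le F_le Fhat_pos
      Lhat_mono Lhat_zero)+

  have zero_in: "0 \<in> \<Omega>" using Omega_nbhd interior_subset by blast
  have L_zero: "0 \<le> L t 0" if "t \<ge> t0" for t
    using f_le_L[OF that zero_in] f_zero[OF that] by simp
  have aux_cont: "continuous_on ({t0..} \<times> {0..}) (\<lambda>(t, X). p t * X + k t * L t X + k t * norm (F t))"
  proof -
    have fst_cont: "continuous_on ({t0..} \<times> {0..}) (\<lambda>w. c (fst w))"
      if "continuous_on {t0..} c" for c :: "real \<Rightarrow> real"
      by (rule continuous_on_compose2[OF that]) (auto intro: continuous_intros)
    have F_norm: "continuous_on {t0..} (\<lambda>t. norm (F t))" by (intro continuous_intros F_cont)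
    have L_pair: "continuous_on ({t0..} \<times> {0..}) (\<lambda>w. L (fst w) (snd w))"
      using L_cont by (simp add: case_prod_unfold)
    show ?thesis
      unfolding case_prod_unfold
      by (intro continuous_on_add continuous_on_mult fst_cont[OF p_cont] fst_cont[OF k_cont]
          fst_cont[OF F_norm] L_pair continuous_on_snd continuous_on_id)
  qed
  have khat_gt_1: "1 < khat" if "CARD('n) \<noteq> 1"
    using condition_number_gt_1[OF W_invertible W_simple that, of t0] k_def[of t0] k_le[of t0] by simp

  have initial: "perturbed_linear_system.amplitude W (\<lambda>t. x t x0) t0 = norm (matrix_inv (W t0) *v x0)"
    if stays: "\<forall>t\<ge>t0. x t x0 \<in> \<Omega>" for x0
  proof -
    interpret majorized_trajectory t0 A W "\<lambda>t. x t x0" "\<lambda>t. f t (x t x0) + F t" p k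
      L "\<lambda>t. norm (F t)" phat khat Fhat Lhat by (rule trajectory[OF stays])
    show ?thesis using x_solution[of x0] by (simp add: amplitude_def W_initial)
  qed

  have bound: "norm (x t x0) \<le> d"
    if d: "0 < d" "Q d Fhat = 0" and x0: "x0 \<in> omega_set W t0 d"
      and stays: "\<forall>t\<ge>t0. x t x0 \<in> \<Omega>" and t: "t \<ge> t0" for d x0 t
  proof -
    interpret majorized_trajectory t0 A W "\<lambda>t. x t x0" "\<lambda>t. f t (x t x0) + F t" p k
      L "\<lambda>t. norm (F t)" phat khat Fhat Lhat by (rule trajectory[OF stays])
    have init: "amplitude t0 \<le> d" using x0 initial[OF stays] by (simp add: omega_set_def)
    have root: "phat * d + (khat * Lhat d + khat * Fhat) \<le> 0" using d(2) by (simp add: Q_eq)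
    show ?thesis
    proof (cases "CARD('n) = 1")
      case True
      show ?thesis
        by (rule norm_le_root_one_dim[OF True refl aux_cont aux_unique L_zero norm_ge_zero
              less_imp_le[OF d(1)] root init t])
    next
      case False
      have "amplitude t \<le> d"
        by (rule amplitude_le_root_multidim[OF khat_gt_1[OF False] less_imp_le[OF d(1)] root init t])
      then show ?thesis using norm_le_amplitude[OF t] by simp
    qed
  qed

  have limit: "Limsup at_top (\<lambda>t. ereal (norm (x t x0))) \<le> ereal d2"
    if d: "d1 > d2" "d2 > 0" and roots: "{X. X > 0 \<and> Q X Fhat = 0} = {d1, d2}"
      and uniq: "\<forall>X0\<in>{0..d1}. unique_ivp (\<lambda>t X. Q X Fhat) {0..} t0 X0"
      and stable: "stable_fixed_solution (\<lambda>X. Q X Fhat) {0..} t0 d2"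
      and Lhat_cont: "continuous_on {0..d1} Lhat"
      and x0: "x0 \<in> omega_set W t0 d1" and stays: "\<forall>t\<ge>t0. x t x0 \<in> \<Omega>"
      and interior: "CARD('n) = 1 \<longrightarrow> norm (matrix_inv (W t0) *v x0) \<noteq> d1" for d1 d2 x0
  proof -
    interpret majorized_trajectory t0 A W "\<lambda>t. x t x0" "\<lambda>t. f t (x t x0) + F t" p k
      L "\<lambda>t. norm (F t)" phat khat Fhat Lhat by (rule trajectory[OF stays])
    have init: "amplitude t0 \<le> d1" using x0 initial[OF stays] by (simp add: omega_set_def)
    have "Q d1 Fhat = 0" using roots by blast
    then have root: "phat * d1 + (khat * Lhat d1 + khat * Fhat) \<le> 0" by (simp add: Q_eq)
    have neg: "phat * X + (khat * Lhat X + khat * Fhat) < 0" if "d2 < X" "X < d1" for X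
      unfolding Q_eq[symmetric]
    proof (rule negative_above_stable_root[where q = "\<lambda>X. Q X Fhat", OF d(2,1) _ _ roots _ stable that])
      show "continuous_on {0..d1} (\<lambda>X. Q X Fhat)"
        unfolding Q_def by (intro continuous_intros Lhat_cont)
      show "0 < Q 0 Fhat" using khat_ge_1 Fhat_pos by (simp add: Q_def Lhat_zero)
      show "\<exists>u. solves_on (\<lambda>_ X. Q X Fhat) {0..} {t0..} u \<and> u t0 = X0" if "X0 \<in> {0..d1}" for X0
        using uniq that unfolding unique_ivp_def by blast
    qed
    have "\<exists>a\<ge>t0. amplitude a < d1"
    proof (cases "CARD('n) = 1")
      case True
      then have "amplitude t0 < d1" using init interior initial[OF stays] by simp
      then show ?thesis by blast
    next
      case False
      show ?thesis
        by (rule exists_amplitude_less_root[OF khat_gt_1[OF False] less_imp_le[OF d(2)] d(1) root neg init])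
    qed
    then obtain a where a: "t0 \<le> a" "amplitude a < d1" by blast
    have Lhat_cont': "continuous_on {d2<..<d1} (\<lambda>X. khat * Lhat X + khat * Fhat)"
      using d by (intro continuous_intros continuous_on_subset[OF Lhat_cont]) auto
    show ?thesis
    proof (rule ereal_le_epsilon2)
      fix e :: real assume "e > 0"
      have "\<forall>\<^sub>F t in at_top. norm (x t x0) \<le> d2 + e"
        by (rule decay.eventually_le_lower_root[OF less_imp_le[OF d(2)] d(1) neg Lhat_cont' a \<open>e > 0\<close>])
      then show "Limsup at_top (\<lambda>t. ereal (norm (x t x0))) \<le> ereal d2 + ereal e"
        by (intro Limsup_bounded) (auto elim: eventually_mono)
    qed
  qed

  show ?thesis
  proof (intro conjI allI impI ballI; (elim conjE)?)
    fix d1 d2 x0 t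
    assume "d2 < d1" "0 < d2" "{X. 0 < X \<and> Q X Fhat = 0} = {d1, d2}"
      "x0 \<in> omega_set W t0 d1" "\<forall>t\<ge>t0. x t x0 \<in> \<Omega>" "t0 \<le> t"
    then show "norm (x t x0) \<le> d1" by (intro bound) auto
  next
    fix d1 d2 x0 t
    assume "d2 < d1" "0 < d2" "{X. 0 < X \<and> Q X Fhat = 0} = {d1, d2}"
      "x0 \<in> omega_set W t0 d2" "\<forall>t\<ge>t0. x t x0 \<in> \<Omega>" "t0 \<le> t"
    then show "norm (x t x0) \<le> d2" by (intro bound) auto
  next
    fix d1 d2 x0
    assume "d2 < d1" "0 < d2" "{X. 0 < X \<and> Q X Fhat = 0} = {d1, d2}"
      "\<forall>X0\<in>{0..d1}. unique_ivp (\<lambda>t X. Q X Fhat) {0..} t0 X0"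
      "stable_fixed_solution (\<lambda>X. Q X Fhat) {0..} t0 d2" "continuous_on {0..d1} Lhat"
      "x0 \<in> omega_set W t0 d1" "\<forall>t\<ge>t0. x t x0 \<in> \<Omega>"
      "CARD('n) = 1 \<longrightarrow> norm (matrix_inv (W t0) *v x0) \<noteq> d1"
    then show "Limsup at_top (\<lambda>t. ereal (norm (x t x0))) \<le> ereal d2" by (rule limit)
  next
    fix d x0 t
    assume "0 < d" "{X. 0 < X \<and> Q X Fhat = 0} = {d}"
      "x0 \<in> omega_set W t0 d" "\<forall>t\<ge>t0. x t x0 \<in> \<Omega>" "t0 \<le> t"
    then show "norm (x t x0) \<le> d" by (intro bound) auto
  qed
qed

end
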